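(* Let $n\ge2$ and $q\ge2$ be integers, let $a>0$, assume $0<b\le1$, and let $ab=1/q$. The Gabor system $\mathcal{G}(B_n,a,1/(qa))$ is a frame for $L^2(\mathbb{R})$ if and only if $a<n$.
   Context: The centered B-splines $B_n:\mathbb{R}\to\mathbb{R}$, $n\in\mathbb{N}$, are defined recursively by $B_1=\chi_{[-1/2,1/2)}$ and $B_{n+1}=B_n*B_1$ (convolution). For $g\in L^2(\mathbb{R})$ and $a,b>0$ the Gabor system is the family $\mathcal{G}(g,a,b)=\{e^{2\pi i b k\,\cdot}\,g(\cdot-am)\}_{k,m\in\mathbb{Z}}$. *)

theory Defs
  imports "HOL-Analysis.Analysis"
begin

text \<open>Elements of \<open>L\<^sup>2(\<real>)\<close> are represented by functions rather than by almost-everywhere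
  classes; the notions below do not distinguish between representatives of the same class.\<close>

definition L2 :: "(real \<Rightarrow> complex) set" where
  "L2 = {f \<in> borel_measurable lebesgue. integrable lebesgue (\<lambda>x. (cmod (f x))\<^sup>2)}"

definition L2_inner :: "(real \<Rightarrow> complex) \<Rightarrow> (real \<Rightarrow> complex) \<Rightarrow> complex" where
  "L2_inner f g = (LINT x|lebesgue. f x * cnj (g x))"

definition L2_norm :: "(real \<Rightarrow> complex) \<Rightarrow> real" where
  "L2_norm f = sqrt (LINT x|lebesgue. (cmod (f x))\<^sup>2)"

text \<open>The explicit summability requirement is needed because \<open>infsum\<close> is \<open>0\<close> on
  non-summable families, which would make the upper bound vacuous there.\<close>

definition L2_frame :: "('i \<Rightarrow> real \<Rightarrow> complex) \<Rightarrow> bool" where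
  "L2_frame e \<longleftrightarrow> (\<forall>i. e i \<in> L2) \<and>
     (\<exists>A B. 0 < A \<and> 0 < B \<and>
       (\<forall>f\<in>L2. (\<lambda>i. (cmod (L2_inner f (e i)))\<^sup>2) summable_on UNIV \<and>
          A * (L2_norm f)\<^sup>2 \<le> (\<Sum>\<^sub>\<infinity>i. (cmod (L2_inner f (e i)))\<^sup>2) \<and>
          (\<Sum>\<^sub>\<infinity>i. (cmod (L2_inner f (e i)))\<^sup>2) \<le> B * (L2_norm f)\<^sup>2))"

definition gabor_system ::
  "(real \<Rightarrow> complex) \<Rightarrow> real \<Rightarrow> real \<Rightarrow> int \<times> int \<Rightarrow> real \<Rightarrow> complex" where
  "gabor_system g a b = (\<lambda>(k, m) x. exp (2 * of_real pi * \<i> * of_real (b * of_int k * x)) *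
     g (x - a * of_int m))"

definition convolution :: "(real \<Rightarrow> real) \<Rightarrow> (real \<Rightarrow> real) \<Rightarrow> real \<Rightarrow> real" where
  "convolution f g x = (LINT t|lebesgue. f (x - t) * g t)"

text \<open>The B-splines are indexed from \<open>1\<close>; the value at index \<open>0\<close> is a dummy.\<close>

fun bspline :: "nat \<Rightarrow> real \<Rightarrow> real" where
  "bspline 0 = (\<lambda>_. 0)"
| "bspline (Suc 0) = indicat_real {-1/2..<1/2}"
| "bspline (Suc (Suc n)) = convolution (bspline (Suc n)) (bspline (Suc 0))"

end

theory Submission imports Defs begin

text \<open>Put \<open>T = q a = 1 / b\<close>, so that the hypothesis \<open>b \<le> 1\<close> reads \<open>T \<ge> 1\<close>, let \<open>g\<close> be the spline, and let \<open>f\<close> be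
  continuous with compact support. For a fixed \<open>m\<close>, Parseval's identity turns the sum over the
  modulations of the squared Gabor coefficients into \<open>T\<close> times the integral over one period of
  \<open>|P\<^sub>m|\<^sup>2\<close>, where \<open>P\<^sub>m(x) = \<Sum>\<^sub>l f(x + l T) g(x + l T - a m)\<close>. Since \<open>T\<close> is the multiple \<open>q a\<close> of the
  translation step, the generating function of \<open>m \<mapsto> P\<^sub>m(x)\<close> factors as
  \<open>\<Sum>\<^sub>m P\<^sub>m(x) e\<^sup>i\<^sup>m\<^sup>\<phi> = (\<Sum>\<^sub>l f(x + l T) e\<^sup>i\<^sup>l\<^sup>q\<^sup>\<phi>) H(\<phi>, x)\<close> with
  \<open>H(\<phi>, x) = \<Sum>\<^sub>m e\<^sup>i\<^sup>m\<^sup>\<phi> g(x - a m)\<close>, which is \<open>modulated_sum\<close> below. While \<open>\<phi>\<close> runs over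
  \<open>[-\<pi>/q, \<pi>/q]\<close>, the angle \<open>q \<phi>\<close> runs over a full period. A lower bound for \<open>|H|\<close> on that range
  of \<open>\<phi>\<close> alone therefore bounds \<open>\<Sum>\<^sub>m |P\<^sub>m(x)|\<^sup>2\<close> from below by \<open>\<Sum>\<^sub>l |f(x + l T)|\<^sup>2\<close>
  (\<open>fiber_lower_bound\<close>), and integration over \<open>x\<close> gives the lower frame bound on a dense subspace.

  The core is that \<open>H(\<phi>, x)\<close> does not vanish when \<open>q |\<phi>| \<le> \<pi>\<close> and \<open>a < n\<close>
  (\<open>modulated_sum_nonzero\<close>). Take \<open>\<phi> \<ge> 0\<close>. The curve \<open>x \<mapsto> H(\<phi>, x)\<close> is rotated by the angle \<open>\<phi>\<close>
  when \<open>x\<close> advances by \<open>a\<close>, and it is conjugated by \<open>x \<mapsto> -x\<close>. Hence, if its argument lies in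
  \<open>[0, \<phi>/2]\<close> over the half period \<open>[0, a/2]\<close>, then its argument lies in \<open>[0, N \<phi>/2]\<close> over
  \<open>[0, N a/2]\<close>. Passing from \<open>B\<^sub>n\<close> to \<open>B\<^sub>n\<^sub>+\<^sub>1\<close> averages \<open>H\<close> over a window of length \<open>1\<close>, and this
  length is at most \<open>q a\<close>. For a window centred in \<open>[0, a/2]\<close> the symmetry cancels the imaginary
  parts at opposite points, and what remains of the window lies in \<open>[0, (q + 1) a/2]\<close>, where the
  argument is at most \<open>(q + 1) \<phi>/2 \<le> 3\<pi>/4\<close> because \<open>q \<ge> 2\<close>. So the imaginary part of the average is
  nonnegative, and its real and imaginary parts have a nonnegative sum. Applied also to the
  curve recentred at \<open>a/2\<close>, this puts the average back into the sector \<open>[0, \<phi>/2]\<close>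
  (\<open>turning_curve_window_integral\<close>). The sum of real and imaginary part is even strictly positive
  as soon as the previous curve is nonzero on some part of the window inside \<open>[0, a/2]\<close>, so that
  nonvanishing is inherited as well.

  Conversely, let \<open>a \<ge> n\<close>. On the part of its support next to the right end point \<open>n/2\<close> the spline
  is small, since for \<open>n \<ge> 2\<close> it is continuous, and all its other translates vanish there. Indicator
  functions of short intervals ending at \<open>n/2\<close> then violate any lower frame bound.\<close>

section \<open>Plane sectors\<close>

text \<open>The origin belongs to every sector: when \<open>a\<close> exceeds the length of the support of a spline, the sums
  of its translates vanish at some points, and their curve has to stay in the sector there too.\<close>

definition sector :: "real \<Rightarrow> complex set" where
  "sector \<beta> = {of_real r * cis t | r t. 0 \<le> r \<and> 0 \<le> t \<and> t \<le> \<beta>}"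

lemma sectorI: "0 \<le> r \<Longrightarrow> 0 \<le> t \<Longrightarrow> t \<le> \<beta> \<Longrightarrow> of_real r * cis t \<in> sector \<beta>"
  unfolding sector_def by blast

lemma sector_mono: "\<alpha> \<le> \<beta> \<Longrightarrow> sector \<alpha> \<subseteq> sector \<beta>"
  unfolding sector_def by force

lemma rotate_sector:
  assumes "z \<in> sector \<beta>" "0 \<le> \<phi>" shows "cis \<phi> * z \<in> sector (\<phi> + \<beta>)"
proof -
  obtain r t where z: "z = of_real r * cis t" "0 \<le> r" "0 \<le> t" "t \<le> \<beta>"
    using assms unfolding sector_def by auto
  have "cis \<phi> * z = of_real r * cis (\<phi> + t)"
    by (simp add: z cis_mult[symmetric] mult_ac)
  then show ?thesis using z(2-) assms(2) sectorI[of r "\<phi> + t" "\<phi> + \<beta>"] by simp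
qed

lemma reflect_sector:
  assumes "z \<in> sector \<beta>" "\<beta> \<le> \<phi>" shows "cis \<phi> * cnj z \<in> sector \<phi>"
proof -
  obtain r t where z: "z = of_real r * cis t" "0 \<le> r" "0 \<le> t" "t \<le> \<beta>"
    using assms unfolding sector_def by auto
  have "cis \<phi> * cnj z = of_real r * cis (\<phi> - t)"
    by (simp add: z cis_cnj cis_mult[symmetric] mult_ac diff_conv_add_uminus del: add_uminus_conv_diff)
  then show ?thesis using z(2-) assms(2) sectorI[of r "\<phi> - t" \<phi>] by simp
qed

lemma sector_Im_nonneg: "z \<in> sector \<beta> \<Longrightarrow> \<beta> \<le> pi \<Longrightarrow> 0 \<le> Im z"
  unfolding sector_def by (auto intro!: mult_nonneg_nonneg sin_ge_zero)

lemma sector_Re_nonneg: "z \<in> sector \<beta> \<Longrightarrow> \<beta> \<le> pi / 2 \<Longrightarrow> 0 \<le> Re z"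
  unfolding sector_def by (auto intro!: mult_nonneg_nonneg cos_ge_zero)

lemma sector_Re_pos:
  assumes "z \<in> sector \<beta>" "\<beta> \<le> pi / 4" "z \<noteq> 0" shows "0 < Re z"
proof -
  obtain r t where z: "z = of_real r * cis t" "0 \<le> r" "0 \<le> t" "t \<le> \<beta>"
    using assms unfolding sector_def by auto
  then have "0 < r" using assms(3) by (auto simp: less_le)
  moreover have "0 < cos t"
    using z(3,4) assms(2) pi_gt_zero by (intro cos_gt_zero_pi; linarith)
  ultimately show ?thesis using z by simp
qed

text \<open>The functional \<open>Re + Im\<close> is nonnegative on the arguments between \<open>-\<pi>/4\<close> and \<open>3\<pi>/4\<close>. It
  replaces the real part, which becomes negative beyond \<open>\<pi>/2\<close>.\<close>

lemma sector_Re_Im_nonneg: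
  assumes "z \<in> sector \<beta>" "\<beta> \<le> 3 * pi / 4" shows "0 \<le> Re z + Im z"
proof -
  obtain r t where z: "z = of_real r * cis t" "0 \<le> r" "0 \<le> t" "t \<le> \<beta>"
    using assms unfolding sector_def by auto
  have "0 \<le> sin (t + pi/4)" using z assms by (intro sin_ge_zero) auto
  also have "sin (t + pi/4) = (cos t + sin t) * (sqrt 2 / 2)"
    by (simp add: sin_add cos_45 sin_45 algebra_simps)
  finally have "0 \<le> cos t + sin t" by (simp add: zero_le_mult_iff)
  then have "0 \<le> r * (cos t + sin t)" using z by simp
  then show ?thesis using z by (simp add: algebra_simps)
qed

text \<open>The two sign conditions on imaginary parts cut out the sector, except that for \<open>\<beta> = 0\<close> they also
  allow the negative real axis; the last hypothesis removes it.\<close>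

lemma mem_sectorI:
  assumes "0 \<le> \<beta>" "\<beta> \<le> pi / 4"
    and "0 \<le> Im z" "Im (cis (-\<beta>) * z) \<le> 0" "0 \<le> Re z + Im z"
  shows "z \<in> sector \<beta>"
proof -
  define t where "t = Arg z"
  have z: "z = of_real (cmod z) * cis t"
    using rcis_cmod_Arg[of z] by (simp add: t_def rcis_def)
  show ?thesis
  proof (cases "z = 0")
    case True then show ?thesis using sectorI[of 0 0 \<beta>] assms by simp
  next
    case False
    then have r: "cmod z > 0" by simp
    have t0: "0 \<le> t" using assms(3) using Arg_less_0[of z] by (simp add: t_def)
    have tpi: "t \<le> pi" using Arg_le_pi by (simp add: t_def)
    have "t \<le> \<beta>"
    proof (rule ccontr)
      assume c: "\<not> t \<le> \<beta>"
      have "cis (-\<beta>) * z = of_real (cmod z) * cis (t - \<beta>)"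
        by (subst z) (simp add: cis_mult[symmetric] mult_ac diff_conv_add_uminus del: add_uminus_conv_diff)
      then have "Im (cis (-\<beta>) * z) = cmod z * sin (t - \<beta>)" by simp
      then have s: "sin (t - \<beta>) \<le> 0" using assms(4) r by (simp add: mult_le_0_iff)
      have "0 < sin (t - \<beta>)" if "t - \<beta> < pi" using c that by (intro sin_gt_zero) auto
      with s have "t - \<beta> \<ge> pi" by force
      then have "t = pi" "\<beta> = 0" using tpi assms by auto
      then have "z = - of_real (cmod z)" using z by simp
      then have "Re z + Im z = - cmod z" by (metis Re_complex_of_real Im_complex_of_real add.right_neutral minus_complex.sel uminus_complex.sel neg_0_equal_iff_equal)
      then show False using assms r by simp
    qed
    then show ?thesis using sectorI[of "cmod z" t \<beta>] z t0 by simp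
  qed
qed

section \<open>Averages over a window of length one\<close>

lemma integral_pos_subinterval:
  fixes f :: "real \<Rightarrow> real"
  assumes int: "f integrable_on {u..v}" and nn: "\<And>t. t \<in> {u..v} \<Longrightarrow> 0 \<le> f t"
    and cd: "c < d" "{c<..<d} \<subseteq> {u..v}" and pos: "\<And>t. c < t \<Longrightarrow> t < d \<Longrightarrow> 0 < f t"
  shows "0 < integral {u..v} f"
proof (rule ccontr)
  assume "\<not> 0 < integral {u..v} f"
  then have I0: "integral {u..v} f = 0"
    using integral_nonneg[OF int nn] by auto
  have ai: "set_integrable lebesgue {u..v} f"
    using nonnegative_absolutely_integrable_1[OF int nn] .
  then have i: "integrable lebesgue (\<lambda>x. indicator {u..v} x *\<^sub>R f x)"
    by (simp add: set_integrable_def)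
  have "(LINT x|lebesgue. indicator {u..v} x *\<^sub>R f x) = 0"
    using set_lebesgue_integral_eq_integral(2)[OF ai] I0 by (simp add: set_lebesgue_integral_def)
  moreover have "AE x in lebesgue. 0 \<le> indicator {u..v} x *\<^sub>R f x"
    using nn by (intro AE_I2) (auto simp: indicator_def)
  ultimately have "AE x in lebesgue. indicator {u..v} x *\<^sub>R f x = 0"
    using integral_nonneg_eq_0_iff_AE[OF i] by auto
  then have "AE x in lebesgue. x \<notin> {c<..<d}"
    using cd pos by (auto simp: indicator_def split: if_splits elim!: eventually_mono)
      (metis greaterThanLessThan_iff less_irrefl subsetD atLeastAtMost_iff)+
  then have "emeasure lebesgue {c<..<d} = 0"
    using AE_iff_measurable[of "{c<..<d}" lebesgue "\<lambda>x. x \<notin> {c<..<d}"]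
    by (simp add: greaterThanLessThan_def greaterThan_def lessThan_def Collect_conj_eq)
  then show False using cd by simp
qed

definition window_integral :: "(real \<Rightarrow> 'a::euclidean_space) \<Rightarrow> real \<Rightarrow> 'a" where
  "window_integral G x = integral {x - 1/2..x + 1/2} G"

lemma continuous_window_integral:
  assumes int: "\<And>u v. G integrable_on {u..v}"
  shows "continuous_on UNIV (window_integral G)"
proof -
  have "continuous_on {u<..<v} (window_integral G)" for u v
  proof -
    define F where "F y = integral {u - 1/2..y} G" for y
    have F: "continuous_on {u - 1/2..v + 1/2} F"
      unfolding F_def by (intro indefinite_integral_continuous_1 int)
    have "continuous_on {u<..<v} (\<lambda>x. F (x + 1/2) - F (x - 1/2))"
      by (intro continuous_on_diff continuous_on_compose2[OF F] continuous_intros) auto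
    then show ?thesis
    proof (rule continuous_on_eq)
      fix x assume x: "x \<in> {u<..<v}"
      have "integral {u - 1/2..x - 1/2} G + integral {x - 1/2..x + 1/2} G = integral {u - 1/2..x + 1/2} G"
        using x by (intro Henstock_Kurzweil_Integration.integral_combine int) auto
      then show "F (x + 1/2) - F (x - 1/2) = window_integral G x"
        by (simp add: F_def window_integral_def algebra_simps)
    qed
  qed
  then have "isCont (window_integral G) x" for x
    using continuous_on_eq_continuous_at[of "{x - 1<..<x + 1}" "window_integral G"] by simp
  then show ?thesis by (simp add: continuous_at_imp_continuous_on)
qed

lemma window_integral_shift: "window_integral (\<lambda>x. G (x + c)) x = window_integral G (x + c)"
proof -
  have "integral {x - 1/2..x + 1/2} (\<lambda>x. G (x + c)) = integral {x - 1/2 + c..x + 1/2 + c} G"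
    using integral_shift_Icc_real[of "x - 1/2" "x + 1/2" G c] by (simp add: o_def add.commute[of _ c])
  then show ?thesis by (simp add: window_integral_def algebra_simps)
qed

lemma window_integral_reflect: "window_integral (\<lambda>x. G (- x)) x = window_integral G (- x)"
  using Henstock_Kurzweil_Integration.integral_reflect_real[of "1/2 - x" "- x - 1/2" G]
  by (simp add: window_integral_def add.commute)

lemma window_integral_cmult:
  fixes G :: "real \<Rightarrow> complex"
  shows "window_integral (\<lambda>x. c * G x) x = c * window_integral G x"
  by (simp add: window_integral_def)

lemma window_integral_cnj: "window_integral (\<lambda>x. cnj (G x)) x = cnj (window_integral G x)"
  by (simp add: window_integral_def integral_cnj)

lemma Re_integral:
  fixes G :: "real \<Rightarrow> complex"
  assumes "G integrable_on S"
  shows "(\<lambda>x. Re (G x)) integrable_on S" "Re (integral S G) = integral S (\<lambda>x. Re (G x))"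
  using integrable_linear[OF assms bounded_linear_Re] integral_linear[OF assms bounded_linear_Re]
  by (simp_all add: o_def)

lemma Im_integral:
  fixes G :: "real \<Rightarrow> complex"
  assumes "G integrable_on S"
  shows "(\<lambda>x. Im (G x)) integrable_on S" "Im (integral S G) = integral S (\<lambda>x. Im (G x))"
  using integrable_linear[OF assms bounded_linear_Im] integral_linear[OF assms bounded_linear_Im]
  by (simp_all add: o_def)

text \<open>The imaginary part of a Hermitian function is odd, so its integral over the part of the window that
  is symmetric about \<open>0\<close> vanishes.\<close>

lemma Im_window_integral_hermitian:
  fixes G :: "real \<Rightarrow> complex"
  assumes int: "\<And>u v. G integrable_on {u..v}" and herm: "\<And>x. G (- x) = cnj (G x)" and "0 \<le> x"
  shows "Im (window_integral G x) = integral {\<bar>1/2 - x\<bar>..1/2 + x} (\<lambda>t. Im (G t))"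
proof (cases "x \<le> 1/2")
  case True
  define h where "h = (\<lambda>t. Im (G t))"
  have hi: "h integrable_on {u..v}" for u v using Im_integral(1)[OF int] by (simp add: h_def)
  have odd: "h (- t) = - h t" for t by (simp add: h_def herm)
  have "integral {x - 1/2..1/2 - x} (\<lambda>t. h (- t)) = integral {x - 1/2..1/2 - x} h"
    using Henstock_Kurzweil_Integration.integral_reflect_real[of "1/2 - x" "x - 1/2" h] by simp
  then have z: "integral {x - 1/2..1/2 - x} h = 0" by (simp add: odd)
  have "Im (window_integral G x) = integral {x - 1/2..x + 1/2} h"
    using Im_integral(2)[OF int] by (simp add: window_integral_def h_def)
  also have "\<dots> = integral {x - 1/2..1/2 - x} h + integral {1/2 - x..x + 1/2} h"
    using True \<open>0 \<le> x\<close> by (intro Henstock_Kurzweil_Integration.integral_combine[symmetric] hi) auto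
  finally show ?thesis using True z by (simp add: h_def add.commute)
next
  case False
  then show ?thesis using Im_integral(2)[OF int]
    by (simp add: window_integral_def add.commute)
qed

section \<open>Turning curves\<close>

text \<open>The symmetries and the sector condition that hold for \<open>x \<mapsto> H(\<phi>, x)\<close>. The two symmetries force
  the value at \<open>0\<close> to be real and the value at \<open>a/2\<close> to be a real multiple of \<open>e\<^sup>i\<^sup>\<phi>\<^sup>/\<^sup>2\<close>; the
  sector condition says that between these two points the argument stays between \<open>0\<close> and \<open>\<phi>/2\<close>. It stands in for
  monotonicity of the argument and needs no continuous choice of it.\<close>

locale turning_curve =
  fixes a \<phi> :: real and G :: "real \<Rightarrow> complex"
  assumes a_pos: "0 < a" and phi_nonneg: "0 \<le> \<phi>"
    and quasi_periodic: "\<And>x. G (x + a) = cis \<phi> * G x"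
    and hermitian: "\<And>x. G (- x) = cnj (G x)"
    and half_period: "\<And>x. 0 \<le> x \<Longrightarrow> x \<le> a / 2 \<Longrightarrow> G x \<in> sector (\<phi> / 2)"
    and integrable: "\<And>u v. G integrable_on {u..v}"
begin

text \<open>Every half period adds at most \<open>\<phi>/2\<close> to the argument: reflection about \<open>a/2\<close> handles the second half
  period, and translation by \<open>a\<close> reduces all later ones.\<close>

lemma in_sector:
  assumes "0 \<le> x" "x \<le> real (Suc k) * (a / 2)"
  shows "G x \<in> sector (real (Suc k) * (\<phi> / 2))"
  using assms
proof (induction k arbitrary: x rule: less_induct)
  case (less k)
  show ?case
  proof (cases "x \<le> a / 2")
    case True
    then show ?thesis using half_period[OF less.prems(1) True] phi_nonneg
        sector_mono[of "\<phi>/2" "real (Suc k) * (\<phi>/2)"] by (force simp: algebra_simps)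
  next
    case x: False
    show ?thesis
    proof (cases "x \<le> a")
      case True
      have k: "k \<ge> 1" using x less.prems by (cases k) auto
      have "G x = cis \<phi> * cnj (G (a - x))"
        using quasi_periodic[of "x - a"] hermitian[of "a - x"] by simp
      moreover have "G (a - x) \<in> sector (\<phi> / 2)" using True x by (intro half_period) auto
      ultimately have "G x \<in> sector \<phi>" using reflect_sector[of "G (a - x)" "\<phi>/2" \<phi>] phi_nonneg by simp
      moreover have "1 * \<phi> \<le> (real (Suc k) / 2) * \<phi>"
        using k phi_nonneg by (intro mult_right_mono) auto
      ultimately show ?thesis using sector_mono[of \<phi> "real (Suc k) * (\<phi>/2)"] by auto
    next
      case False
      have "k \<ge> 2"
      proof (rule ccontr)
        assume "\<not> 2 \<le> k"
        then have "real (Suc k) * (a / 2) \<le> 2 * (a / 2)" using a_pos by (intro mult_right_mono) auto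
        then show False using less.prems False by simp
      qed
      then obtain j where j: "k = Suc (Suc j)" by (metis add_2_eq_Suc le_Suc_ex)
      have "G (x - a) \<in> sector (real (Suc j) * (\<phi> / 2))"
        using False less.prems j by (intro less.IH) (auto simp: algebra_simps)
      then have "cis \<phi> * G (x - a) \<in> sector (\<phi> + real (Suc j) * (\<phi> / 2))"
        by (rule rotate_sector) (rule phi_nonneg)
      then show ?thesis using quasi_periodic[of "x - a"] j by (simp add: field_simps)
    qed
  qed
qed

text \<open>Recentring at \<open>a/2\<close> and rotating back by \<open>\<phi>/2\<close> exchanges the two symmetry points, so each bound at
  the lower edge of the sector yields one at the upper edge.\<close>

lemma half_period_shift: "turning_curve a \<phi> (\<lambda>y. cis (- (\<phi> / 2)) * G (a / 2 + y))"
proof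
  fix x
  have c: "cis (- (\<phi> / 2)) * cis \<phi> = cis (\<phi> / 2)" by (simp add: cis_mult)
  have G: "G (a / 2 + x) = cis \<phi> * cnj (G (a / 2 - x))" for x
    using quasi_periodic[of "x - a / 2"] hermitian[of "a / 2 - x"] by (simp add: algebra_simps)
  have K: "cis (- (\<phi> / 2)) * G (a / 2 + x) = cis (\<phi> / 2) * cnj (G (a / 2 - x))" for x
    by (simp add: G mult.assoc[symmetric] c)
  show "cis (- (\<phi> / 2)) * G (a / 2 + (x + a)) = cis \<phi> * (cis (- (\<phi> / 2)) * G (a / 2 + x))"
    using quasi_periodic[of "a / 2 + x"] by (simp add: algebra_simps)
  show "cis (- (\<phi> / 2)) * G (a / 2 + - x) = cnj (cis (- (\<phi> / 2)) * G (a / 2 + x))"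
    by (simp add: K cis_cnj)
  show "cis (- (\<phi> / 2)) * G (a / 2 + x) \<in> sector (\<phi> / 2)" if "0 \<le> x" "x \<le> a / 2"
    unfolding K using that by (intro reflect_sector[OF half_period]) auto
  have "(\<lambda>y. G (y + a / 2)) integrable_on {u..v}" for u v
    using integrable_shift_real_ivl_iff[of G "a / 2" "u + a / 2" "v + a / 2"] integrable by simp
  then show "(\<lambda>y. cis (- (\<phi> / 2)) * G (a / 2 + y)) integrable_on {u..v}" for u v
    by (intro integrable_on_mult_right) (simp add: add.commute)
qed (fact a_pos phi_nonneg)+

text \<open>After the cancellation of imaginary parts, the window reaches no further than \<open>(q + 1) a/2\<close>, where
  the argument is at most \<open>(q + 1) \<phi>/2 \<le> \<pi>\<close>.\<close>

lemma Im_window_integral_nonneg: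
  assumes "1 \<le> real q * a" "real q * \<phi> \<le> pi" "1 \<le> q" "0 \<le> x" "x \<le> a / 2"
  shows "0 \<le> Im (window_integral G x)"
proof -
  have "0 \<le> Im (G t)" if "t \<in> {\<bar>1/2 - x\<bar>..1/2 + x}" for t
  proof (rule sector_Im_nonneg)
    show "G t \<in> sector (real (Suc q) * (\<phi> / 2))"
      using assms that by (intro in_sector) (auto simp: algebra_simps)
    have "1 * \<phi> \<le> real q * \<phi>" using assms phi_nonneg by (intro mult_right_mono) auto
    then show "real (Suc q) * (\<phi> / 2) \<le> pi" using assms by (simp add: algebra_simps)
  qed
  then show ?thesis
    unfolding Im_window_integral_hermitian[OF integrable hermitian \<open>0 \<le> x\<close>]
    by (intro Henstock_Kurzweil_Integration.integral_nonneg Im_integral integrable)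
qed

text \<open>The second claim carries nonvanishing from a curve to its average: the window then overlaps a
  nontrivial interval on which the integrand \<open>f\<close> of the proof is strictly positive.\<close>

lemma Re_Im_window_integral:
  assumes qa: "1 \<le> real q * a" and q\<phi>: "real q * \<phi> \<le> pi" and q: "2 \<le> q"
    and x: "0 \<le> x" "x \<le> a / 2"
  shows "0 \<le> Re (window_integral G x) + Im (window_integral G x)"
    and "\<lbrakk>1/2 \<le> d; x < d + 1/2; \<And>t. 0 \<le> t \<Longrightarrow> t \<le> a / 2 \<Longrightarrow> t < d \<Longrightarrow> G t \<noteq> 0\<rbrakk>
      \<Longrightarrow> 0 < Re (window_integral G x) + Im (window_integral G x)"
proof -
  \<comment> \<open>\<open>J\<close> is what remains of the window \<open>W\<close> after the cancellation of imaginary parts. On the rest of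
    \<open>W\<close>, which lies in \<open>[-1/2, 1/2]\<close>, the real part alone is nonnegative.\<close>
  define J where "J = {\<bar>1/2 - x\<bar>..1/2 + x}"
  define W where "W = {x - 1/2..x + 1/2}"
  define f where "f t = Re (G t) + (if t \<in> J then Im (G t) else 0)" for t
  have JW: "J \<subseteq> W" by (auto simp: J_def W_def)
  have Ji: "(\<lambda>t. if t \<in> J then Im (G t) else 0) integrable_on W"
    using integrable_restrict_Int[of J "\<lambda>t. Im (G t)" W] JW Im_integral(1)[OF integrable]
    by (simp add: Int_absorb2 J_def)
  have Ri: "(\<lambda>t. Re (G t)) integrable_on W"
    unfolding W_def by (intro Re_integral integrable)
  have fi: "f integrable_on W" unfolding f_def by (intro integrable_add Ri Ji)
  have eq: "Re (window_integral G x) + Im (window_integral G x) = integral W f"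
  proof -
    have "integral W f = integral W (\<lambda>t. Re (G t)) + integral W (\<lambda>t. if t \<in> J then Im (G t) else 0)"
      unfolding f_def by (intro Henstock_Kurzweil_Integration.integral_add Ri Ji)
    also have "integral W (\<lambda>t. if t \<in> J then Im (G t) else 0) = integral J (\<lambda>t. Im (G t))"
      using JW by (simp add: integral_restrict_Int Int_absorb2)
    finally show ?thesis
      using Im_window_integral_hermitian[OF integrable hermitian x(1)] Re_integral(2)[OF integrable]
      by (simp add: J_def W_def window_integral_def)
  qed
  have \<phi>q: "\<phi> * 2 \<le> pi"
    using q\<phi> mult_right_mono[of 2 "real q" \<phi>] q phi_nonneg by simp
  have nn: "0 \<le> f t" if "t \<in> W" for t
  proof (cases "t \<in> J")
    case True
    have "0 \<le> Re (G t) + Im (G t)"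
    proof (rule sector_Re_Im_nonneg)
      show "G t \<in> sector (real (Suc q) * (\<phi> / 2))"
        using assms True unfolding J_def by (intro in_sector) (auto simp: algebra_simps)
      show "real (Suc q) * (\<phi> / 2) \<le> 3 * pi / 4"
        using \<phi>q q\<phi> by (simp add: algebra_simps)
    qed
    then show ?thesis using True by (simp add: f_def)
  next
    case False
    then have t: "\<bar>t\<bar> \<le> 1/2" using that x by (auto simp: W_def J_def)
    obtain k where k: "q = Suc k" using q by (cases q) auto
    have "G \<bar>t\<bar> \<in> sector (real (Suc k) * (\<phi> / 2))"
      using t qa k by (intro in_sector) (auto simp: algebra_simps)
    then have "0 \<le> Re (G \<bar>t\<bar>)" using q\<phi> k by (intro sector_Re_nonneg) (auto simp: algebra_simps)
    moreover have "Re (G \<bar>t\<bar>) = Re (G t)" using hermitian[of t] by (auto simp: abs_if)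
    ultimately show ?thesis using False by (simp add: f_def)
  qed
  show "0 \<le> Re (window_integral G x) + Im (window_integral G x)"
    unfolding eq using fi nn by (rule Henstock_Kurzweil_Integration.integral_nonneg)
  assume d: "1/2 \<le> d" "x < d + 1/2" "\<And>t. 0 \<le> t \<Longrightarrow> t \<le> a / 2 \<Longrightarrow> t < d \<Longrightarrow> G t \<noteq> 0"
  define c where "c = max 0 (x - 1/2)"
  define e where "e = min (a / 2) (min (x + 1/2) d)"
  show "0 < Re (window_integral G x) + Im (window_integral G x)"
    unfolding eq W_def
  proof (rule integral_pos_subinterval)
    show "c < e" using d(1,2) x a_pos unfolding c_def e_def max_def min_def by (simp; linarith)
    show "{c<..<e} \<subseteq> {x - 1/2..x + 1/2}" by (auto simp: c_def e_def)
    show "0 < f t" if "c < t" "t < e" for t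
    proof -
      have t: "0 \<le> t" "t \<le> a / 2" "t < d" using that by (auto simp: c_def e_def)
      have s: "G t \<in> sector (\<phi> / 2)" using t by (intro half_period)
      have "0 < Re (G t)" using d(3)[OF t] \<phi>q by (intro sector_Re_pos[OF s]) auto
      moreover have "0 \<le> Im (G t)" by (rule sector_Im_nonneg[OF s]) (use \<phi>q pi_gt_zero in linarith)
      ultimately show ?thesis by (simp add: f_def)
    qed
  qed (use fi nn in \<open>auto simp: W_def\<close>)
qed

theorem turning_curve_window_integral:
  assumes qa: "1 \<le> real q * a" and q\<phi>: "real q * \<phi> \<le> pi" and q: "2 \<le> q"
  shows "turning_curve a \<phi> (window_integral G)"
proof
  fix x
  \<comment> \<open>The recentred curve supplies the upper edge of the sector.\<close>
  interpret K: turning_curve a \<phi> "\<lambda>y. cis (- (\<phi> / 2)) * G (a / 2 + y)"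
    by (rule half_period_shift)
  show qp: "window_integral G (x + a) = cis \<phi> * window_integral G x" for x
    using window_integral_shift[of G a x] by (simp add: quasi_periodic window_integral_cmult)
  show he: "window_integral G (- x) = cnj (window_integral G x)" for x
    using window_integral_reflect[of G x] by (simp add: hermitian window_integral_cnj)
  have \<phi>q: "\<phi> * 2 \<le> pi"
    using q\<phi> mult_right_mono[of 2 "real q" \<phi>] q phi_nonneg by simp
  show "window_integral G x \<in> sector (\<phi> / 2)" if x: "0 \<le> x" "x \<le> a / 2"
  proof (rule mem_sectorI)
    show "0 \<le> Im (window_integral G x)" using Im_window_integral_nonneg[OF qa q\<phi> _ x] q by simp
    show "0 \<le> Re (window_integral G x) + Im (window_integral G x)"
      by (rule Re_Im_window_integral(1)[OF qa q\<phi> q x])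
    have "window_integral (\<lambda>y. cis (- (\<phi> / 2)) * G (a / 2 + y)) (a / 2 - x)
        = cis (- (\<phi> / 2)) * window_integral G (a - x)"
      using window_integral_shift[of G "a / 2" "a / 2 - x"]
      by (simp add: window_integral_cmult add.commute)
    also have "window_integral G (a - x) = cis \<phi> * cnj (window_integral G x)"
      using qp[of "- x"] he[of x] by (simp add: algebra_simps)
    also have "cis (- (\<phi> / 2)) * (cis \<phi> * cnj (window_integral G x)) = cnj (cis (- (\<phi> / 2)) * window_integral G x)"
      by (simp add: cis_cnj mult.assoc[symmetric] cis_mult)
    finally show "Im (cis (- (\<phi> / 2)) * window_integral G x) \<le> 0"
      using K.Im_window_integral_nonneg[OF qa q\<phi>, of "a / 2 - x"] q x by simp
  qed (use \<phi>q phi_nonneg in auto)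
  show "window_integral G integrable_on {u..v}" for u v
  proof -
    have "continuous_on UNIV (window_integral G)"
      by (intro continuous_window_integral integrable)
    then show ?thesis by (meson continuous_on_subset integrable_continuous_real subset_UNIV)
  qed
qed (fact a_pos phi_nonneg)+

end

section \<open>Centred B-splines\<close>

text \<open>Here \<open>spline k\<close> is the centred B-spline \<open>B\<^sub>k\<^sub>+\<^sub>1\<close>, except that \<open>spline 0\<close> is the indicator of the open
  instead of the half-open interval. This makes all of them even without changing any integral.\<close>

primrec spline :: "nat \<Rightarrow> real \<Rightarrow> real" where
  "spline 0 = indicat_real {-1/2<..<1/2}"
| "spline (Suc k) = window_integral (spline k)"

lemma integrable_indicator_Ioo: "indicat_real {c<..<d} integrable_on {u..v}" for c d u v :: real
proof -
  have "{c<..<d} \<inter> {u..v} \<in> lmeasurable"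
    by (intro fmeasurable_Int_fmeasurable fmeasurableD lmeasurable_interval)
  then have "(\<lambda>x. 1::real) integrable_on ({c<..<d} \<inter> {u..v})"
    by (rule integrable_on_const)
  then show ?thesis
    using integrable_restrict_Int[of "{c<..<d}" "\<lambda>x. 1::real" "{u..v}"]
    by (simp add: indicator_def[abs_def] of_bool_def)
qed

lemma continuous_spline_Suc: "continuous_on UNIV (spline (Suc k))"
  and spline_integrable: "spline k integrable_on {u..v}"
proof (induction k arbitrary: u v)
  case 0
  show "spline 0 integrable_on {u..v}" for u v using integrable_indicator_Ioo by simp
  then show "continuous_on UNIV (spline (Suc 0))"
    using continuous_window_integral[of "spline 0"] by simp
next
  case (Suc k)
  show *: "spline (Suc k) integrable_on {u..v}" for u v
    using Suc(1) by (meson continuous_on_subset integrable_continuous_real subset_UNIV)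
  show "continuous_on UNIV (spline (Suc (Suc k)))"
    using continuous_window_integral[OF *] by simp
qed

lemma continuous_spline: "1 \<le> k \<Longrightarrow> continuous_on A (spline k)"
  using continuous_spline_Suc[of "k - 1"] by (cases k) (auto intro: continuous_on_subset)

lemma spline_even: "spline k (- x) = spline k x"
proof (induction k arbitrary: x)
  case 0 show ?case by (auto simp: indicator_def)
next
  case (Suc k)
  then show ?case using window_integral_reflect[of "spline k" x] by simp
qed

lemma spline_eq_0: "(real k + 1) / 2 \<le> \<bar>x\<bar> \<Longrightarrow> spline k x = 0"
proof (induction k arbitrary: x)
  case 0 then show ?case by (auto simp: indicator_def)
next
  case (Suc k)
  have "window_integral (spline k) \<bar>x\<bar> = 0"
  proof -
    have "integral {\<bar>x\<bar> - 1/2..\<bar>x\<bar> + 1/2} (spline k) = integral {\<bar>x\<bar> - 1/2..\<bar>x\<bar> + 1/2} (\<lambda>_. 0)"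
      using Suc.prems by (intro integral_cong Suc.IH) (auto simp: field_simps)
    then show ?thesis by (simp add: window_integral_def)
  qed
  then show ?case using spline_even[of "Suc k" x] by (auto simp: abs_if split: if_splits)
qed

lemma integral_reflected_window: "integral {-1/2..1/2} (\<lambda>t. f (x - t)) = window_integral f x"
  for f :: "real \<Rightarrow> real"
proof -
  have "integral {-1/2..1/2} (\<lambda>t. f (x - t)) = integral {-1/2..1/2} (\<lambda>t. f (t + x))"
    using Henstock_Kurzweil_Integration.integral_reflect_real[of "1/2" "-1/2" "\<lambda>t. f (t + x)"] by (simp add: algebra_simps)
  also have "\<dots> = window_integral f x"
    using window_integral_shift[of f x 0] by (simp add: window_integral_def)
  finally show ?thesis .
qed

lemma convolution_bspline_1:
  assumes "f \<in> borel_measurable borel" "\<And>x. \<bar>f x\<bar> \<le> C"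
  shows "convolution f (bspline (Suc 0)) x = window_integral f x"
proof -
  have si: "set_integrable lebesgue {-1/2..<1/2} (\<lambda>t. f (x - t))"
  proof -
    have "integrable lborel (\<lambda>t. indicator {-1/2..<1/2} t *\<^sub>R f (x - t))"
    proof (rule integrableI_bounded_set_indicator[where B = C])
      show "(\<lambda>t. f (x - t)) \<in> borel_measurable lborel" using assms(1) by measurable
    qed (use assms in auto)
    then show ?thesis unfolding set_integrable_def by (rule integrable_completion[THEN iffD2, rotated]) (use assms in measurable)
  qed
  have "convolution f (bspline (Suc 0)) x = (LINT t:{-1/2..<1/2}|lebesgue. f (x - t))"
    by (simp add: convolution_def set_lebesgue_integral_def mult.commute)
  also have "\<dots> = integral {-1/2..<1/2} (\<lambda>t. f (x - t))"
    by (rule set_lebesgue_integral_eq_integral(2)[OF si])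
  also have "\<dots> = integral {-1/2..1/2} (\<lambda>t. f (x - t))"
    by (rule integral_spike_set; rule negligible_subset[of "{1/2}"]) auto
  finally show ?thesis by (simp only: integral_reflected_window)
qed

lemma spline_bounded:
  assumes "1 \<le> k"
  obtains C where "\<And>x. \<bar>spline k x\<bar> \<le> C"
proof -
  define r where "r = (real k + 1) / 2"
  have "bounded (spline k ` {-r..r})"
    by (intro compact_imp_bounded compact_continuous_image continuous_spline assms compact_Icc)
  then obtain C where C: "\<And>x. x \<in> {-r..r} \<Longrightarrow> \<bar>spline k x\<bar> \<le> C"
    unfolding bounded_iff real_norm_def by blast
  show thesis
  proof (rule that)
    show "\<bar>spline k x\<bar> \<le> max C 0" for x
    proof (cases "\<bar>x\<bar> \<le> r")
      case True
      then have "x \<in> {-r..r}" by (auto simp: abs_le_iff)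
      from C[OF this] show ?thesis by linarith
    next
      case False then show ?thesis using spline_eq_0[of k x] by (simp add: r_def)
    qed
  qed
qed

lemma bspline_eq_spline: "bspline (Suc (Suc k)) = spline (Suc k)"
proof (induction k)
  case 0
  have "convolution (bspline (Suc 0)) (bspline (Suc 0)) x = window_integral (spline 0) x" for x
  proof -
    have "convolution (bspline (Suc 0)) (bspline (Suc 0)) x = window_integral (bspline (Suc 0)) x"
      by (intro convolution_bspline_1[where C = 1]) (auto simp: indicator_def)
    also have "\<dots> = window_integral (spline 0) x"
      unfolding window_integral_def
      by (rule integral_spike[of "{-1/2}"]) (auto simp: indicator_def)
    finally show ?thesis .
  qed
  then show ?case by (simp add: fun_eq_iff)
next
  case (Suc k)
  have "spline (Suc k) \<in> borel_measurable borel"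
    by (intro borel_measurable_continuous_onI continuous_spline_Suc)
  moreover obtain C where "\<And>x. \<bar>spline (Suc k) x\<bar> \<le> C" using spline_bounded[of "Suc k"] by auto
  ultimately have conv: "convolution (spline (Suc k)) (bspline (Suc 0)) x = window_integral (spline (Suc k)) x" for x
    by (rule convolution_bspline_1)
  have "bspline (Suc (Suc (Suc k))) = convolution (spline (Suc k)) (bspline (Suc 0))"
    unfolding bspline.simps(3)[of "Suc k"] Suc ..
  also have "\<dots> = spline (Suc (Suc k))"
    unfolding spline.simps(2)[of "Suc k"] by (rule ext) (rule conv)
  finally show ?case .
qed

section \<open>Modulated sums of spline translates do not vanish\<close>

lemma abs_less_addI: "\<bar>x - t\<bar> < r \<Longrightarrow> 0 \<le> x \<Longrightarrow> x \<le> c \<Longrightarrow> \<bar>t\<bar> < c + r" for x t r c :: real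
  by (auto simp: abs_if split: if_splits)

lemma card_lattice_interval:
  fixes x a R :: real
  assumes a: "0 < a" and R: "0 \<le> R"
  shows "finite {m::int. \<bar>x - a * m\<bar> \<le> R}"
    and "real (card {m::int. \<bar>x - a * m\<bar> \<le> R}) \<le> 2 * R / a + 1"
proof -
  have sub: "{m::int. \<bar>x - a * m\<bar> \<le> R} \<subseteq> {\<lceil>(x - R) / a\<rceil>..\<lfloor>(x + R) / a\<rfloor>}"
  proof
    fix m :: int assume "m \<in> {m::int. \<bar>x - a * m\<bar> \<le> R}"
    then have "\<bar>x - a * m\<bar> \<le> R" by simp
    then have "(x - R) / a \<le> m" "m \<le> (x + R) / a" using a by (auto simp: field_simps abs_le_iff)
    then show "m \<in> {\<lceil>(x - R) / a\<rceil>..\<lfloor>(x + R) / a\<rfloor>}" by (simp add: ceiling_le le_floor_iff)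
  qed
  then show "finite {m::int. \<bar>x - a * m\<bar> \<le> R}" by (rule finite_subset) simp
  have "real (card {m::int. \<bar>x - a * m\<bar> \<le> R}) \<le> real (card {\<lceil>(x - R) / a\<rceil>..\<lfloor>(x + R) / a\<rfloor>})"
    using card_mono[OF _ sub] by simp
  also have "\<dots> \<le> (x + R) / a - (x - R) / a + 1"
  proof -
    have "real_of_int (\<lfloor>(x + R) / a\<rfloor> - \<lceil>(x - R) / a\<rceil> + 1) \<le> (x + R) / a - (x - R) / a + 1"
      by simp linarith
    moreover have "(x + R) / a - (x - R) / a + 1 \<ge> 0" using a R by (simp add: field_simps)
    ultimately show ?thesis by (simp add: of_nat_nat max_def)
  qed
  also have "\<dots> = 2 * R / a + 1" using a by (simp add: field_simps)
  finally show "real (card {m::int. \<bar>x - a * m\<bar> \<le> R}) \<le> 2 * R / a + 1" .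
qed

text \<open>The discrete counterpart of the cancellation in \<open>Im_window_integral_hermitian\<close>: the terms whose mirror image is also present
  cancel in pairs.\<close>

lemma sum_antisymmetric_nonneg:
  fixes s :: "'i \<Rightarrow> real"
  assumes fin: "finite I" and inv: "\<And>m. \<sigma> (\<sigma> m) = m" and anti: "\<And>m. s (\<sigma> m) = - s m"
    and rest: "\<And>m. m \<in> I \<Longrightarrow> \<sigma> m \<notin> I \<Longrightarrow> 0 \<le> s m"
  shows "0 \<le> sum s I"
proof -
  define J where "J = {m \<in> I. \<sigma> m \<in> I}"
  have "sum s J = (\<Sum>m\<in>J. s (\<sigma> m))"
    by (rule sum.reindex_bij_witness[of _ \<sigma> \<sigma>]) (auto simp: J_def inv)
  then have "sum s J = 0" by (simp add: anti sum_negf)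
  moreover have "sum s I = sum s J + sum s (I - J)"
    using fin by (subst sum.subset_diff[of J]) (auto simp: J_def)
  moreover have "0 \<le> sum s (I - J)" using rest by (intro sum_nonneg) (auto simp: J_def)
  ultimately show ?thesis by simp
qed

definition modulated_sum :: "real \<Rightarrow> real \<Rightarrow> nat \<Rightarrow> real \<Rightarrow> complex" where
  "modulated_sum a \<phi> k x =
     (\<Sum>m | \<bar>x - a * of_int m\<bar> < (real k + 1) / 2. cis (\<phi> * of_int m) * of_real (spline k (x - a * of_int m)))"

text \<open>The index set in the definition moves with \<open>x\<close>. For integration and for continuity it has to be
  replaced by a fixed finite one.\<close>

lemma modulated_sum_eq:
  assumes "finite S" "\<And>m. \<bar>x - a * of_int m\<bar> < (real k + 1) / 2 \<Longrightarrow> m \<in> S"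
  shows "modulated_sum a \<phi> k x = (\<Sum>m\<in>S. cis (\<phi> * of_int m) * of_real (spline k (x - a * of_int m)))"
  unfolding modulated_sum_def using assms
  by (intro sum.mono_neutral_left) (auto simp: spline_eq_0)

lemma finite_translates: "0 < a \<Longrightarrow> finite {m::int. \<bar>x - a * of_int m\<bar> < R}" for a x R :: real
  using card_lattice_interval(1)[of a "\<bar>R\<bar>" x] by (rule_tac finite_subset) auto

lemma modulated_sum_shift: "modulated_sum a \<phi> k (x + a * of_int j) = cis (\<phi> * of_int j) * modulated_sum a \<phi> k x"
proof -
  have "modulated_sum a \<phi> k (x + a * of_int j) = (\<Sum>m | \<bar>x - a * of_int m\<bar> < (real k + 1) / 2.
      cis (\<phi> * of_int (m + j)) * of_real (spline k (x + a * of_int j - a * of_int (m + j))))"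
    unfolding modulated_sum_def
    by (rule sum.reindex_bij_witness[of _ "\<lambda>m. m + j" "\<lambda>m. m - j"]) (auto simp: algebra_simps)
  also have "\<dots> = cis (\<phi> * of_int j) * modulated_sum a \<phi> k x"
    unfolding modulated_sum_def sum_distrib_left
    by (intro sum.cong) (auto simp: algebra_simps cis_mult[symmetric])
  finally show ?thesis .
qed

lemma modulated_sum_uminus: "modulated_sum a \<phi> k (- x) = cnj (modulated_sum a \<phi> k x)"
proof -
  have h: "\<bar>- x - a * of_int m\<bar> = \<bar>x + a * of_int m\<bar>" for m :: int by (simp add: abs_if)
  have "modulated_sum a \<phi> k (- x) = (\<Sum>m | \<bar>x - a * of_int m\<bar> < (real k + 1) / 2.
      cis (\<phi> * of_int (- m)) * of_real (spline k (- x - a * of_int (- m))))"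
    unfolding modulated_sum_def
    by (rule sum.reindex_bij_witness[of _ uminus uminus]) (auto simp: h)
  also have "\<dots> = cnj (modulated_sum a \<phi> k x)"
    unfolding modulated_sum_def cnj_sum
    using spline_even[of k "x - a * of_int m" for m]
    by (intro sum.cong) (auto simp: algebra_simps cis_cnj)
  finally show ?thesis .
qed

lemma modulated_sum_cnj: "modulated_sum a (- \<phi>) k x = cnj (modulated_sum a \<phi> k x)"
  unfolding modulated_sum_def cnj_sum by (intro sum.cong) (auto simp: cis_cnj)

lemma modulated_sum_integrable:
  assumes "0 < a" shows "modulated_sum a \<phi> k integrable_on {u..v}"
proof -
  define S where "S = {m::int. \<bar>u - a * of_int m\<bar> < \<bar>v - u\<bar> + (real k + 1) / 2}"
  have "(\<lambda>x. \<Sum>m\<in>S. cis (\<phi> * of_int m) * of_real (spline k (x - a * of_int m))) integrable_on {u..v}"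
  proof (intro integrable_sum integrable_on_mult_right)
    show fin: "finite S" unfolding S_def by (rule finite_translates[OF assms])
    fix m :: int
    have "(\<lambda>x. spline k (x - a * of_int m)) integrable_on {u..v}"
      using integrable_shift_real_ivl_iff[of "spline k" "- a * of_int m" "u - a * of_int m" "v - a * of_int m"]
        spline_integrable by simp
    then show "(\<lambda>x. complex_of_real (spline k (x - a * of_int m))) integrable_on {u..v}"
      using integrable_linear[OF _ bounded_linear_of_real] by (fastforce simp: o_def)
  qed
  then show ?thesis
  proof (rule integrable_eq)
    fix x assume "x \<in> {u..v}"
    then show "(\<Sum>m\<in>S. cis (\<phi> * of_int m) * of_real (spline k (x - a * of_int m))) = modulated_sum a \<phi> k x"
      unfolding S_def mem_Collect_eq
      by (intro modulated_sum_eq[symmetric] finite_translates assms) (smt (verit) atLeastAtMost_iff mem_Collect_eq)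
  qed
qed

lemma modulated_sum_Suc:
  assumes "0 < a" shows "modulated_sum a \<phi> (Suc k) = window_integral (modulated_sum a \<phi> k)"
proof
  fix x
  define S where "S = {m::int. \<bar>x - a * of_int m\<bar> < (real (Suc k) + 1) / 2}"
  have fin: "finite S" unfolding S_def by (rule finite_translates[OF assms])
  have mem: "m \<in> S" if "t \<in> {x - 1/2..x + 1/2}" "\<bar>t - a * of_int m\<bar> < (real k + 1) / 2" for t m
    unfolding S_def using that by (auto simp: abs_if field_simps split: if_splits)
  have int': "(\<lambda>x. spline k (x - a * of_int m)) integrable_on {x - 1/2..x + 1/2}" for m
      using integrable_shift_real_ivl_iff[of "spline k" "- a * of_int m" "x - 1/2 - a * of_int m" "x + 1/2 - a * of_int m"]
        spline_integrable by simp
  have int: "(\<lambda>x. complex_of_real (spline k (x - a * of_int m))) integrable_on {x - 1/2..x + 1/2}" for m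
    using integrable_linear[OF int' bounded_linear_of_real] by (simp add: o_def)
  have ofr: "window_integral (\<lambda>x. complex_of_real (spline k (x - a * of_int m))) x
      = of_real (spline (Suc k) (x - a * of_int m))" for m
    using window_integral_shift[of "spline k" "- a * of_int m" x]
      integral_linear[OF int' bounded_linear_of_real[where 'a = complex]]
    by (simp add: window_integral_def o_def)
  have "window_integral (modulated_sum a \<phi> k) x =
      window_integral (\<lambda>t. \<Sum>m\<in>S. cis (\<phi> * of_int m) * of_real (spline k (t - a * of_int m))) x"
    unfolding window_integral_def
    using fin mem by (intro integral_cong modulated_sum_eq)
  also have "\<dots> = (\<Sum>m\<in>S. cis (\<phi> * of_int m) * window_integral (\<lambda>x. of_real (spline k (x - a * of_int m))) x)"
    unfolding window_integral_def
    by (subst integral_sum[OF fin]) (auto intro!: integrable_on_mult_right int)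
  also have "\<dots> = modulated_sum a \<phi> (Suc k) x"
    by (simp only: ofr) (simp add: modulated_sum_def S_def)
  finally show "modulated_sum a \<phi> (Suc k) x = window_integral (modulated_sum a \<phi> k) x" by simp
qed

text \<open>For the indicator function the sum runs over the integers \<open>m\<close> with \<open>|x - a m| < 1/2\<close>. If
  \<open>0 \<le> x \<le> a/2\<close>, they satisfy \<open>2 |m| \<le> q\<close>, so all the phases lie in \<open>[-\<pi>/2, \<pi>/2]\<close> and the real parts
  are nonnegative. The index set leans to the right of \<open>0\<close> and to the left of \<open>1/2\<close>, which gives the
  signs of the two imaginary parts.\<close>

lemma modulated_sum_0:
  assumes a: "0 < a" and qa: "1 \<le> real q * a" and q\<phi>: "real q * \<phi> \<le> pi" and q: "2 \<le> q"
    and \<phi>: "0 \<le> \<phi>"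
  shows "turning_curve a \<phi> (modulated_sum a \<phi> 0)"
    and "0 \<le> x \<Longrightarrow> x \<le> a / 2 \<Longrightarrow> x < 1/2 \<Longrightarrow> modulated_sum a \<phi> 0 x \<noteq> 0"
proof -
  define I where "I x = {m::int. \<bar>x - a * of_int m\<bar> < 1/2}" for x
  have H: "modulated_sum a \<phi> 0 x = (\<Sum>m\<in>I x. cis (\<phi> * of_int m))" for x
  proof -
    have "spline 0 y = 1" if "\<bar>y\<bar> < 1/2" for y using that by (auto simp: indicator_def abs_less_iff)
    then show ?thesis unfolding modulated_sum_def I_def by (intro sum.cong) (auto simp del: spline.simps)
  qed
  have fin: "finite (I x)" for x unfolding I_def by (rule finite_translates[OF a])
  have \<phi>2: "\<phi> * 2 \<le> pi"
    using q\<phi> mult_right_mono[of 2 "real q" \<phi>] q \<phi> by simp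
  have mphi: "\<phi> * \<bar>of_int m\<bar> \<le> pi / 2" if "m \<in> I x" "0 \<le> x" "x \<le> a / 2" for m x
  proof -
    have "\<bar>a * of_int m\<bar> < (real q + 1) * a / 2"
      using abs_less_addI[of x "a * of_int m" "1/2" "a / 2"] that qa
      unfolding I_def by (auto simp: algebra_simps)
    then have "a * (2 * \<bar>of_int m\<bar>) < a * (real q + 1)" using a by (simp add: abs_mult algebra_simps)
    then have "2 * \<bar>of_int m\<bar> < real q + 1" using a by simp
    then have "2 * \<bar>m\<bar> \<le> int q" by linarith
    then have "2 * \<bar>of_int m\<bar> \<le> real q" by linarith
    then have "\<phi> * (2 * \<bar>of_int m\<bar>) \<le> \<phi> * real q" using \<phi> by (rule mult_left_mono)
    then show ?thesis using q\<phi> by (simp add: algebra_simps)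
  qed
  have cos_nn: "0 \<le> cos (\<phi> * of_int m)" if "m \<in> I x" "0 \<le> x" "x \<le> a / 2" for m x
  proof -
    have "\<bar>\<phi> * of_int m\<bar> \<le> pi / 2" using mphi[OF that] \<phi> by (simp add: abs_mult)
    then show ?thesis by (intro cos_ge_zero) (auto simp: abs_le_iff)
  qed
  have Re_nn: "0 \<le> Re (modulated_sum a \<phi> 0 x)" if "0 \<le> x" "x \<le> a / 2" for x
    unfolding H using cos_nn that by (auto intro!: sum_nonneg)
  show "modulated_sum a \<phi> 0 x \<noteq> 0" if x: "0 \<le> x" "x \<le> a / 2" "x < 1/2"
  proof -
    have "(\<Sum>m\<in>{0}. cos (\<phi> * of_int m)) \<le> (\<Sum>m\<in>I x. cos (\<phi> * of_int m))"
      using x cos_nn fin by (intro sum_mono2) (auto simp: I_def)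
    then have "Re (modulated_sum a \<phi> 0 x) \<ge> 1" by (simp add: H)
    then show ?thesis by auto
  qed
  show "turning_curve a \<phi> (modulated_sum a \<phi> 0)"
  proof
    fix x
    show "modulated_sum a \<phi> 0 (x + a) = cis \<phi> * modulated_sum a \<phi> 0 x"
      using modulated_sum_shift[of a \<phi> 0 x 1] by simp
    assume x: "0 \<le> x" "x \<le> a / 2"
    show "modulated_sum a \<phi> 0 x \<in> sector (\<phi> / 2)"
    proof (rule mem_sectorI)
      show im: "0 \<le> Im (modulated_sum a \<phi> 0 x)"
        unfolding H Im_sum cis.sel
      proof (rule sum_antisymmetric_nonneg[OF fin, where \<sigma> = uminus])
        fix m assume m: "m \<in> I x" "- m \<notin> I x"
        have "0 \<le> m"
        proof (rule ccontr)
          assume "\<not> 0 \<le> m"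
          then have "a * of_int m \<le> 0" using a by (simp add: mult_le_0_iff)
          then show False using m x by (auto simp: I_def abs_if split: if_splits)
        qed
        then show "0 \<le> sin (\<phi> * of_int m)"
          using mphi[OF m(1) x] \<phi> pi_gt_zero by (intro sin_ge_zero; simp; linarith)
      qed auto
      have "0 \<le> (\<Sum>m\<in>I x. - sin (\<phi> * (of_int m - 1/2)))"
      proof (rule sum_antisymmetric_nonneg[OF fin, where \<sigma> = "\<lambda>m. 1 - m"])
        fix m :: int
        have "\<phi> * (of_int (1 - m) - 1/2) = - (\<phi> * (of_int m - 1/2))" by (simp add: algebra_simps)
        then show "- sin (\<phi> * (of_int (1 - m) - 1/2)) = - (- sin (\<phi> * (of_int m - 1/2)))"
          by (simp only: sin_minus)
      next
        fix m assume m: "m \<in> I x" "1 - m \<notin> I x"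
        have "m \<le> 0"
        proof (rule ccontr)
          assume "\<not> m \<le> 0"
          then have "a * 1 \<le> a * of_int m" using a by (intro mult_left_mono) auto
          then show False using m x by (auto simp: I_def abs_less_iff algebra_simps)
        qed
        then have "\<phi> * \<bar>of_int m\<bar> = - (\<phi> * of_int m)" "\<phi> * of_int m \<le> 0"
          using \<phi> by (auto simp: mult_le_0_iff)
        then have "0 \<le> sin (\<phi> * (1/2 - of_int m))"
          using mphi[OF m(1) x] \<phi> \<phi>2 pi_gt_zero
          by (intro sin_ge_zero; simp only: right_diff_distrib; linarith)
        moreover have "\<phi> * (of_int m - 1/2) = - (\<phi> * (1/2 - of_int m))" by (simp add: algebra_simps)
        ultimately show "0 \<le> - sin (\<phi> * (of_int m - 1/2))" by (simp only: sin_minus minus_minus)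
      qed simp
      moreover have "cis (- (\<phi> / 2)) * modulated_sum a \<phi> 0 x = (\<Sum>m\<in>I x. cis (\<phi> * (of_int m - 1/2)))"
        unfolding H sum_distrib_left cis_mult by (simp add: algebra_simps)
      ultimately show "Im (cis (- (\<phi> / 2)) * modulated_sum a \<phi> 0 x) \<le> 0"
        by (simp add: sum_negf)
      show "0 \<le> Re (modulated_sum a \<phi> 0 x) + Im (modulated_sum a \<phi> 0 x)"
        using Re_nn[OF x] im by simp
    qed (use \<phi> \<phi>2 in auto)
  qed (use a \<phi> modulated_sum_uminus modulated_sum_integrable in auto)
qed

lemma modulated_sum_turning:
  assumes "0 < a" and "1 \<le> real q * a" and "real q * \<phi> \<le> pi" and "2 \<le> q" and "0 \<le> \<phi>"
  shows "turning_curve a \<phi> (modulated_sum a \<phi> k)"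
proof (induction k)
  case 0 show ?case by (rule modulated_sum_0(1)[OF assms])
next
  case (Suc k)
  then show ?case unfolding modulated_sum_Suc[OF assms(1)]
    using turning_curve.turning_curve_window_integral assms by blast
qed

text \<open>The bound on \<open>x\<close> says that \<open>x\<close> is interior to the support of the spline, without which every
  term of the sum can vanish; it grows by \<open>1/2\<close> with each average, as the support does.\<close>

lemma modulated_sum_nonzero_half_period:
  assumes a: "0 < a" "1 \<le> real q * a" "real q * \<phi> \<le> pi" "2 \<le> q" "0 \<le> \<phi>"
    and x: "0 \<le> x" "x \<le> a / 2" "x < (real k + 1) / 2"
  shows "modulated_sum a \<phi> k x \<noteq> 0"
  using x
proof (induction k arbitrary: x)
  case 0 then show ?case using modulated_sum_0(2)[OF a] by simp
next
  case (Suc k)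
  interpret turning_curve a \<phi> "modulated_sum a \<phi> k" using modulated_sum_turning[OF a] .
  have "0 < Re (window_integral (modulated_sum a \<phi> k) x) + Im (window_integral (modulated_sum a \<phi> k) x)"
    using Suc by (intro Re_Im_window_integral(2)[OF a(2-4), where d = "(real k + 1) / 2"]) (auto simp: field_simps)
  then show ?case unfolding modulated_sum_Suc[OF a(1)] by auto
qed

text \<open>For \<open>a < k + 1\<close>, every point is within \<open>a/2 < (k + 1)/2\<close> of the lattice \<open>a \<int>\<close>, so the symmetries
  reduce it to an interior point of the support.\<close>

theorem modulated_sum_nonzero:
  assumes a: "0 < a" "1 \<le> real q * a" "2 \<le> q" and \<phi>: "real q * \<bar>\<phi>\<bar> \<le> pi" and k: "a < real k + 1"
  shows "modulated_sum a \<phi> k x \<noteq> 0"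
proof -
  have pos: "modulated_sum a \<phi> k x \<noteq> 0" if \<phi>: "0 \<le> \<phi>" "real q * \<phi> \<le> pi" for \<phi> x
  proof -
    define j where "j = round (x / a)"
    define y where "y = x - a * of_int j"
    have "\<bar>x / a - of_int j\<bar> \<le> 1/2" unfolding j_def
      using of_int_round_abs_le[of "x / a"] by (simp add: abs_minus_commute)
    moreover have "y = (x / a - of_int j) * a" using a by (simp add: y_def field_simps)
    ultimately have y: "\<bar>y\<bar> \<le> a / 2" using a by (simp add: abs_mult)
    have "modulated_sum a \<phi> k \<bar>y\<bar> \<noteq> 0"
      using y k by (intro modulated_sum_nonzero_half_period[OF a(1,2) \<phi>(2) a(3) \<phi>(1)]) auto
    then have "modulated_sum a \<phi> k y \<noteq> 0"
      using modulated_sum_uminus[of a \<phi> k y] by (auto simp: abs_if split: if_splits)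
    then show ?thesis using modulated_sum_shift[of a \<phi> k y j] by (simp add: y_def)
  qed
  show ?thesis
  proof (cases "0 \<le> \<phi>")
    case True then show ?thesis using pos \<phi> by simp
  next
    case False
    then have "modulated_sum a (- \<phi>) k x \<noteq> 0" using pos[of "- \<phi>" x] \<phi> by simp
    then show ?thesis by (simp add: modulated_sum_cnj)
  qed
qed

theorem modulated_sum_bounded_below:
  assumes a: "0 < a" "1 \<le> real q * a" "2 \<le> q" and k: "a < real k + 1" "1 \<le> k"
  obtains \<delta> where "0 < \<delta>" "\<And>x \<phi>. real q * \<bar>\<phi>\<bar> \<le> pi \<Longrightarrow> \<delta> \<le> cmod (modulated_sum a \<phi> k x)"
proof -
  define C where "C = {0..a} \<times> {- pi / real q..pi / real q}"
  define S where "S = {m::int. \<bar>0 - a * of_int m\<bar> < a + (real k + 1) / 2}"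
  define h where "h p = cmod (\<Sum>m\<in>S. cis (snd p * of_int m) * of_real (spline k (fst p - a * of_int m)))" for p :: "real \<times> real"
  have fin: "finite S" unfolding S_def by (rule finite_translates[OF a(1)])
  have h: "h (x, \<phi>) = cmod (modulated_sum a \<phi> k x)" if "0 \<le> x" "x \<le> a" for x \<phi>
    unfolding h_def fst_conv snd_conv
    using that abs_less_addI[of x "a * of_int m" "(real k + 1) / 2" a for m]
    by (subst modulated_sum_eq[OF fin]) (auto simp: S_def)
  have ne: "C \<noteq> {}" using a by (auto simp: C_def)
  have "continuous_on C h" unfolding h_def
    by (intro continuous_intros continuous_on_compose2[OF continuous_spline[OF k(2), of UNIV]]) auto
  moreover have "compact C" unfolding C_def by (intro compact_Times compact_Icc)
  ultimately obtain p where p: "p \<in> C" "\<And>r. r \<in> C \<Longrightarrow> h p \<le> h r"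
    using continuous_attains_inf[of C h] ne by auto
  have mem: "(x, \<phi>) \<in> C \<longleftrightarrow> 0 \<le> x \<and> x \<le> a \<and> real q * \<bar>\<phi>\<bar> \<le> pi" for x \<phi>
  proof -
    have "real q * \<bar>\<phi>\<bar> \<le> pi \<longleftrightarrow> \<bar>\<phi>\<bar> \<le> pi / real q" using a by (simp add: field_simps)
    then show ?thesis by (auto simp: C_def abs_le_iff)
  qed
  show thesis
  proof (rule that)
    obtain x \<phi> where "p = (x, \<phi>)" by (cases p)
    then show "0 < h p" using p(1) mem h modulated_sum_nonzero[OF a _ k(1)] by simp
    fix x \<phi> assume \<phi>: "real q * \<bar>\<phi>\<bar> \<le> pi"
    define j where "j = \<lfloor>x / a\<rfloor>"
    define y where "y = x - a * of_int j"
    have "0 \<le> x / a - of_int j" "x / a - of_int j \<le> 1" unfolding j_def by linarith+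
    moreover have "y = (x / a - of_int j) * a" using a by (simp add: y_def field_simps)
    ultimately have y: "0 \<le> y" "y \<le> a" using a by auto
    have "h p \<le> cmod (modulated_sum a \<phi> k y)" using p(2)[of "(y, \<phi>)"] y \<phi> h mem by simp
    also have "\<dots> = cmod (modulated_sum a \<phi> k x)"
      using modulated_sum_shift[of a \<phi> k y j] by (simp add: y_def norm_mult)
    finally show "h p \<le> cmod (modulated_sum a \<phi> k x)" .
  qed
qed

section \<open>Square-integrable functions\<close>

lemma integral_lebesgue_continuous:
  fixes f :: "real \<Rightarrow> 'b::euclidean_space"
  assumes "continuous_on {u..v} f"
  shows "integrable lebesgue (\<lambda>x. indicator {u..v} x *\<^sub>R f x)"
    and "(LINT x|lebesgue. indicator {u..v} x *\<^sub>R f x) = integral {u..v} f"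
proof -
  have "set_integrable lebesgue {u..v} f"
    using absolutely_integrable_continuous_real[OF assms] by simp
  then show "integrable lebesgue (\<lambda>x. indicator {u..v} x *\<^sub>R f x)"
    and "(LINT x|lebesgue. indicator {u..v} x *\<^sub>R f x) = integral {u..v} f"
    using set_lebesgue_integral_eq_integral(2)[of "{u..v}" f]
    by (auto simp: set_integrable_def set_lebesgue_integral_def)
qed

lemma integrable_L2_bounded_support:
  assumes h: "h \<in> L2" and supp: "\<And>x. x \<notin> {u..v} \<Longrightarrow> h x = 0"
  shows "integrable lebesgue h"
proof (rule Bochner_Integration.integrable_bound)
  show "integrable lebesgue (\<lambda>x. indicator {u..v} x *\<^sub>R (1::real) + (cmod (h x))\<^sup>2)"
    using h by (intro Bochner_Integration.integrable_add integral_lebesgue_continuous) (auto simp: L2_def)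
  show "h \<in> borel_measurable lebesgue" using h by (simp add: L2_def)
  have "r \<le> 1 + r\<^sup>2" for r :: real
    using sum_power2_ge_zero[of "r - 1/2" 0] by (simp add: power2_eq_square algebra_simps)
  then show "AE x in lebesgue. norm (h x) \<le> norm (indicator {u..v} x *\<^sub>R (1::real) + (cmod (h x))\<^sup>2)"
    using supp by (intro AE_I2) (auto simp: indicator_def)
qed

lemma L2_mult_bounded:
  assumes h: "h \<in> L2" and g: "g \<in> borel_measurable lebesgue" "\<And>x. cmod (g x) \<le> C"
  shows "(\<lambda>x. h x * g x) \<in> L2"
  unfolding L2_def mem_Collect_eq
proof
  show m: "(\<lambda>x. h x * g x) \<in> borel_measurable lebesgue" using h g by (auto simp: L2_def)
  show "integrable lebesgue (\<lambda>x. (cmod (h x * g x))\<^sup>2)"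
  proof (rule Bochner_Integration.integrable_bound)
    show "integrable lebesgue (\<lambda>x. C\<^sup>2 * (cmod (h x))\<^sup>2)" using h by (auto simp: L2_def)
    show "(\<lambda>x. (cmod (h x * g x))\<^sup>2) \<in> borel_measurable lebesgue" using m by measurable
    have "(cmod (h x * g x))\<^sup>2 \<le> C\<^sup>2 * (cmod (h x))\<^sup>2" for x
      using power_mono[OF g(2)[of x], of 2] mult_right_mono[of "(cmod (g x))\<^sup>2" "C\<^sup>2" "(cmod (h x))\<^sup>2"]
      by (simp add: norm_mult power_mult_distrib mult.commute)
    then show "AE x in lebesgue. norm ((cmod (h x * g x))\<^sup>2) \<le> norm (C\<^sup>2 * (cmod (h x))\<^sup>2)"
      by (intro AE_I2) simp
  qed
qed

lemma L2_bounded_support: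
  assumes m: "f \<in> borel_measurable lebesgue" and b: "\<And>x. cmod (f x) \<le> C" and s: "\<And>x. R < \<bar>x\<bar> \<Longrightarrow> f x = 0"
  shows "f \<in> L2"
  unfolding L2_def mem_Collect_eq
proof
  show "integrable lebesgue (\<lambda>x. (cmod (f x))\<^sup>2)"
  proof (rule Bochner_Integration.integrable_bound)
    show "integrable lebesgue (\<lambda>x. C\<^sup>2 * indicator {-R..R} x)"
      by (intro integrable_mult_right integrable_real_indicator) (auto simp: emeasure_lborel_Icc_eq)
    show "(\<lambda>x. (cmod (f x))\<^sup>2) \<in> borel_measurable lebesgue" using m by measurable
    have "(cmod (f x))\<^sup>2 \<le> C\<^sup>2 * indicator {-R..R} x" for x
      using power_mono[OF b[of x], of 2] s[of x] by (auto simp: indicator_def abs_if split: if_splits)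
    then show "AE x in lebesgue. norm ((cmod (f x))\<^sup>2) \<le> norm (C\<^sup>2 * indicator {-R..R} x)"
      by (intro AE_I2) simp
  qed
qed (rule m)

lemma tendsto_L2_dominated:
  fixes g :: "nat \<Rightarrow> real \<Rightarrow> complex"
  assumes m: "\<And>n. g n \<in> borel_measurable lebesgue" "f \<in> borel_measurable lebesgue"
    and w: "integrable lebesgue w" and b: "\<And>n x. (cmod (f x - g n x))\<^sup>2 \<le> w x"
    and lim: "AE x in lebesgue. (\<lambda>n. g n x) \<longlonglongrightarrow> f x"
  shows "(\<lambda>n. LINT x|lebesgue. (cmod (f x - g n x))\<^sup>2) \<longlonglongrightarrow> 0"
proof -
  have "(\<lambda>n. LINT x|lebesgue. (cmod (f x - g n x))\<^sup>2) \<longlonglongrightarrow> (LINT x::real|lebesgue. 0)"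
  proof (rule integral_dominated_convergence[OF _ _ w])
    show "AE x in lebesgue. (\<lambda>n. (cmod (f x - g n x))\<^sup>2) \<longlonglongrightarrow> 0"
      using lim
    proof eventually_elim
      case (elim x)
      have "(\<lambda>n. (cmod (f x - g n x))\<^sup>2) \<longlonglongrightarrow> (cmod (f x - f x))\<^sup>2"
        by (intro tendsto_intros elim)
      then show ?case by simp
    qed
  qed (use m b in \<open>auto intro!: measurable\<close>)
  then show ?thesis by simp
qed

lemma L2_approx_bounded_support:
  assumes f: "f \<in> L2" and "0 < \<epsilon>"
  obtains N :: nat where "(LINT x|lebesgue. (cmod (f x - (if \<bar>x\<bar> \<le> N \<and> cmod (f x) \<le> N then f x else 0)))\<^sup>2) < \<epsilon>"
proof -
  define g where "g N x = (if \<bar>x\<bar> \<le> real N \<and> cmod (f x) \<le> real N then f x else 0)" for N :: nat and x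
  have fm: "f \<in> borel_measurable lebesgue" using f by (simp add: L2_def)
  have "(\<lambda>N. LINT x|lebesgue. (cmod (f x - g N x))\<^sup>2) \<longlonglongrightarrow> 0"
  proof (rule tendsto_L2_dominated)
    show "integrable lebesgue (\<lambda>x. (cmod (f x))\<^sup>2)" using f by (simp add: L2_def)
    have "(\<lambda>x::real. x) \<in> borel_measurable lebesgue" by (simp add: measurable_completion)
    then show "g n \<in> borel_measurable lebesgue" for n
      unfolding g_def using fm by measurable
    show "AE x in lebesgue. (\<lambda>n. g n x) \<longlonglongrightarrow> f x"
    proof (intro AE_I2 tendsto_eventually)
      fix x
      obtain n0 :: nat where n0: "\<bar>x\<bar> + cmod (f x) \<le> n0" using real_arch_simple by blast
      show "eventually (\<lambda>n. g n x = f x) sequentially"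
        using eventually_ge_at_top[of n0]
      proof eventually_elim
        case (elim n)
        then have "\<bar>x\<bar> + cmod (f x) \<le> real n" using n0 by linarith
        then show ?case using norm_ge_zero[of "f x"] abs_ge_zero[of x] unfolding g_def by (auto simp del: norm_ge_zero abs_ge_zero)
      qed
    qed
  qed (use fm in \<open>auto simp: g_def\<close>)
  then have "eventually (\<lambda>N. (LINT x|lebesgue. (cmod (f x - g N x))\<^sup>2) < \<epsilon>) sequentially"
    using \<open>0 < \<epsilon>\<close> by (rule order_tendstoD)
  then obtain N where "(LINT x|lebesgue. (cmod (f x - g N x))\<^sup>2) < \<epsilon>"
    by (meson eventually_happens trivial_limit_sequentially)
  then show thesis using that by (simp add: g_def)
qed

text \<open>Radial projection onto the disc of radius \<open>M\<close>. It restores the uniform bound that pointwise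
  approximation by continuous functions loses and that dominated convergence needs.\<close>

definition clip :: "real \<Rightarrow> complex \<Rightarrow> complex" where
  "clip M z = z /\<^sub>R max 1 (cmod z / M)"

lemma norm_clip: "0 < M \<Longrightarrow> cmod (clip M z) \<le> M"
  by (cases "cmod z \<le> M") (auto simp: clip_def max_def field_simps)

lemma clip_id: "0 < M \<Longrightarrow> cmod z \<le> M \<Longrightarrow> clip M z = z"
  by (simp add: clip_def max_def field_simps)

lemma continuous_clip: "0 < M \<Longrightarrow> continuous_on UNIV (clip M)"
  unfolding clip_def by (intro continuous_intros) (auto simp: max_def)

text \<open>Lebesgue measurability supplies continuous functions converging to \<open>f\<close> almost everywhere. Clipping
  their values and multiplying by a cutoff function keeps the limit and provides a dominating
  function.\<close>

lemma L2_approx_continuous: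
  fixes f :: "real \<Rightarrow> complex"
  assumes m: "f \<in> borel_measurable lebesgue" and M: "0 < M"
    and b: "\<And>x. cmod (f x) \<le> M" and s: "\<And>x. R < \<bar>x\<bar> \<Longrightarrow> f x = 0" and "0 < \<epsilon>"
  obtains g where "continuous_on UNIV g" "\<And>x. R + 1 < \<bar>x\<bar> \<Longrightarrow> g x = 0" "\<And>x. cmod (g x) \<le> M"
    "(LINT x|lebesgue. (cmod (f x - g x))\<^sup>2) < \<epsilon>"
proof -
  have "f measurable_on UNIV" using m by (simp add: measurable_on_iff_borel_measurable)
  then obtain N h where N: "negligible N" and h: "\<And>n. continuous_on UNIV (h n)"
    and lim: "\<And>x. x \<notin> N \<Longrightarrow> (\<lambda>n. h n x) \<longlonglongrightarrow> f x"
    unfolding measurable_on_def by auto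
  define cut where "cut x = max 0 (min 1 (R + 1 - \<bar>x\<bar>))" for x :: real
  define g where "g n x = of_real (cut x) * clip M (h n x)" for n x
  have gb: "cmod (g n x) \<le> M" for n x
    using mult_mono[of "\<bar>cut x\<bar>" 1 "cmod (clip M (h n x))" M] norm_clip[OF M]
    by (auto simp: g_def norm_mult cut_def)
  have gs: "g n x = 0" if "R + 1 < \<bar>x\<bar>" for n x using that by (simp add: g_def cut_def)
  have gc: "continuous_on UNIV (g n)" for n
    unfolding g_def cut_def
    by (intro continuous_intros continuous_on_compose2[OF continuous_clip[OF M] h]) auto
  have "(\<lambda>n. LINT x|lebesgue. (cmod (f x - g n x))\<^sup>2) \<longlonglongrightarrow> 0"
  proof (rule tendsto_L2_dominated)
    show "g n \<in> borel_measurable lebesgue" for n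
      using borel_measurable_continuous_onI[OF gc] by (simp add: measurable_completion)
    show "integrable lebesgue (\<lambda>x. (2 * M)\<^sup>2 * indicator {-(R+1)..R+1} x)"
      by (intro integrable_mult_right integrable_real_indicator) (auto simp: emeasure_lborel_Icc_eq)
    show "(cmod (f x - g n x))\<^sup>2 \<le> (2 * M)\<^sup>2 * indicator {-(R+1)..R+1} x" for n x
    proof (cases "\<bar>x\<bar> \<le> R + 1")
      case True
      have "cmod (f x - g n x) \<le> 2 * M" using norm_triangle_ineq4[of "f x" "g n x"] b[of x] gb[of n x] by linarith
      then have "(cmod (f x - g n x))\<^sup>2 \<le> (2 * M)\<^sup>2" by (intro power_mono) auto
      then show ?thesis using True by (auto simp: abs_le_iff)
    next
      case False then show ?thesis using s[of x] gs[of x n] by simp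
    qed
    have "x \<notin> N \<longrightarrow> (\<lambda>n. g n x) \<longlonglongrightarrow> f x" for x
    proof
      assume "x \<notin> N"
      have "isCont (clip M) (f x)" using continuous_clip[OF M] by (simp add: continuous_on_eq_continuous_at)
      then have "(\<lambda>n. g n x) \<longlonglongrightarrow> of_real (cut x) * clip M (f x)"
        unfolding g_def by (intro tendsto_intros isCont_tendsto_compose[OF _ lim] \<open>x \<notin> N\<close>)
      moreover have "of_real (cut x) * clip M (f x) = f x"
      proof (cases "\<bar>x\<bar> \<le> R")
        case True then show ?thesis by (simp add: cut_def clip_id[OF M b])
      next
        case False then show ?thesis using s[of x] by (simp add: clip_def)
      qed
      ultimately show "(\<lambda>n. g n x) \<longlonglongrightarrow> f x" by simp
    qed
    moreover have "AE x in lebesgue. x \<notin> N"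
      using N by (intro AE_not_in) (simp add: negligible_iff_null_sets)
    ultimately show "AE x in lebesgue. (\<lambda>n. g n x) \<longlonglongrightarrow> f x" by auto
  qed (rule m)
  then have "eventually (\<lambda>n. (LINT x|lebesgue. (cmod (f x - g n x))\<^sup>2) < \<epsilon>) sequentially"
    using \<open>0 < \<epsilon>\<close> by (rule order_tendstoD)
  then obtain n where "(LINT x|lebesgue. (cmod (f x - g n x))\<^sup>2) < \<epsilon>"
    by (meson eventually_happens trivial_limit_sequentially)
  then show thesis using that[of "g n"] gc gs gb by blast
qed

lemma cmod_add_square_le: "(cmod (z + w))\<^sup>2 \<le> 2 * (cmod z)\<^sup>2 + 2 * (cmod w)\<^sup>2"
proof -
  have "(cmod (z + w))\<^sup>2 \<le> (cmod z + cmod w)\<^sup>2" by (intro power_mono norm_triangle_ineq) auto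
  also have "\<dots> \<le> 2 * (cmod z)\<^sup>2 + 2 * (cmod w)\<^sup>2"
    using sum_squares_bound[of "cmod z" "cmod w"] by (simp add: power2_sum)
  finally show ?thesis .
qed

lemma L2_diff:
  assumes "f \<in> L2" "g \<in> L2" shows "(\<lambda>x. f x - g x) \<in> L2"
proof -
  have m: "(\<lambda>x. f x - g x) \<in> borel_measurable lebesgue" using assms by (auto simp: L2_def)
  have sq: "(cmod (z - w))\<^sup>2 \<le> 2 * (cmod z)\<^sup>2 + 2 * (cmod w)\<^sup>2" for z w
    using cmod_add_square_le[of z "- w"] by simp
  have "integrable lebesgue (\<lambda>x. (cmod (f x - g x))\<^sup>2)"
  proof (rule Bochner_Integration.integrable_bound)
    show "integrable lebesgue (\<lambda>x. 2 * (cmod (f x))\<^sup>2 + 2 * (cmod (g x))\<^sup>2)"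
      using assms by (auto simp: L2_def)
    show "(\<lambda>x. (cmod (f x - g x))\<^sup>2) \<in> borel_measurable lebesgue" using m by measurable
  qed (use sq in auto)
  then show ?thesis using m by (simp add: L2_def)
qed

lemma L2_norm_square_triangle:
  assumes "f \<in> L2" "g \<in> L2"
  shows "(LINT x|lebesgue. (cmod (f x))\<^sup>2) \<le> 2 * (LINT x|lebesgue. (cmod (g x))\<^sup>2) + 2 * (LINT x|lebesgue. (cmod (f x - g x))\<^sup>2)"
proof -
  have i: "integrable lebesgue (\<lambda>x. (cmod (g x))\<^sup>2)" "integrable lebesgue (\<lambda>x. (cmod (f x - g x))\<^sup>2)" "integrable lebesgue (\<lambda>x. (cmod (f x))\<^sup>2)"
    using assms L2_diff[OF assms] by (auto simp: L2_def)
  have "(LINT x|lebesgue. (cmod (f x))\<^sup>2) \<le> (LINT x|lebesgue. 2 * (cmod (g x))\<^sup>2 + 2 * (cmod (f x - g x))\<^sup>2)"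
    using i cmod_add_square_le[of "g x" "f x - g x" for x] by (intro integral_mono) auto
  then show ?thesis using i by simp
qed

lemma L2_dense_continuous:
  assumes f: "f \<in> L2" and "0 < \<epsilon>"
  obtains g R where "continuous_on UNIV g" "\<And>x. R < \<bar>x\<bar> \<Longrightarrow> g x = 0" "g \<in> L2"
    "(LINT x|lebesgue. (cmod (f x - g x))\<^sup>2) < \<epsilon>"
proof -
  obtain N :: nat where N: "(LINT x|lebesgue. (cmod (f x - (if \<bar>x\<bar> \<le> N \<and> cmod (f x) \<le> N then f x else 0)))\<^sup>2) < \<epsilon> / 4"
    using L2_approx_bounded_support[OF f, of "\<epsilon> / 4"] \<open>0 < \<epsilon>\<close> by auto
  define h where "h x = (if \<bar>x\<bar> \<le> N \<and> cmod (f x) \<le> N then f x else 0)" for x :: real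
  have fm: "f \<in> borel_measurable lebesgue" using f by (simp add: L2_def)
  have "(\<lambda>x::real. x) \<in> borel_measurable lebesgue" by (simp add: measurable_completion)
  then have hm: "h \<in> borel_measurable lebesgue" unfolding h_def using fm by measurable
  have hb: "cmod (h x) \<le> real N + 1" for x by (simp add: h_def)
  have hs: "h x = 0" if "real N < \<bar>x\<bar>" for x using that by (simp add: h_def)
  obtain g where g: "continuous_on UNIV g" "\<And>x. real N + 1 < \<bar>x\<bar> \<Longrightarrow> g x = 0" "\<And>x. cmod (g x) \<le> real N + 1"
    "(LINT x|lebesgue. (cmod (h x - g x))\<^sup>2) < \<epsilon> / 4"
    using \<open>0 < \<epsilon>\<close> by (rule_tac L2_approx_continuous[OF hm _ hb hs, where \<epsilon> = "\<epsilon> / 4"]) auto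
  have hL: "h \<in> L2" by (rule L2_bounded_support[OF hm hb hs])
  have "g \<in> borel_measurable lebesgue"
    using borel_measurable_continuous_onI[OF g(1)] by (simp add: measurable_completion)
  then have gL: "g \<in> L2" using g by (intro L2_bounded_support[of g "real N + 1" "real N + 1"]) auto
  have "(LINT x|lebesgue. (cmod (f x - g x))\<^sup>2) \<le> 2 * (LINT x|lebesgue. (cmod (h x - g x))\<^sup>2) + 2 * (LINT x|lebesgue. (cmod (f x - h x))\<^sup>2)"
    using L2_norm_square_triangle[OF L2_diff[OF f gL] L2_diff[OF hL gL]] by simp
  also have "\<dots> < \<epsilon>" using N g(4) by (simp add: h_def)
  finally show thesis using that g gL by blast
qed

section \<open>Fourier series: orthogonality, Bessel and Parseval\<close>

lemma integral_cis:
  assumes "0 < T" "1 \<le> N"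
  shows "integral {u..u + real N * T} (\<lambda>x. cis (2 * pi * of_int k * x / T)) = (if k = 0 then of_real (real N * T) else 0)"
proof (cases "k = 0")
  case True then show ?thesis using assms by (simp add: scaleR_conv_of_real)
next
  case False
  define c where "c = 2 * pi * of_int k / T"
  have c: "c \<noteq> 0" using False assms by (simp add: c_def)
  have d: "((\<lambda>x. cis (c * x) / (\<i> * of_real c)) has_vector_derivative cis (c * x)) (at x within S)" for x S
  proof -
    have "((\<lambda>z. exp (\<i> * of_real c * z) / (\<i> * of_real c)) has_field_derivative exp (\<i> * of_real c * z)) (at z)" for z
      using c by (auto intro!: derivative_eq_intros)
    from has_vector_derivative_real_field[OF this, of x S]
    show ?thesis by (simp add: cis_conv_exp mult_ac)
  qed
  have "((\<lambda>x. cis (c * x)) has_integral (cis (c * (u + real N * T)) / (\<i> * of_real c) - cis (c * u) / (\<i> * of_real c))) {u..u + real N * T}"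
    using assms by (intro fundamental_theorem_of_calculus d) auto
  moreover have "cis (c * (u + real N * T)) = cis (c * u)"
  proof -
    have "c * (u + real N * T) = c * u + 2 * pi * of_int (k * int N)" using assms by (simp add: c_def field_simps)
    then show ?thesis by (simp add: cis_mult[symmetric] cis_multiple_2pi)
  qed
  ultimately have "((\<lambda>x. cis (c * x)) has_integral 0) {u..u + real N * T}" by simp
  then show ?thesis using False by (simp add: integral_unique c_def)
qed

lemma continuous_cis_linear [continuous_intros]:
  "continuous_on A f \<Longrightarrow> continuous_on A (\<lambda>x. cis (f x))"
  by (simp add: cis_conv_exp) (intro continuous_intros)

lemma integral_of_real_complex:
  fixes f :: "'a::euclidean_space \<Rightarrow> real"
  assumes "f integrable_on A"
  shows "integral A (\<lambda>x. complex_of_real (f x)) = of_real (integral A f)"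
  using integral_linear[OF assms bounded_linear_of_real[where 'a = complex]] by (simp add: o_def)

text \<open>The integral extends over \<open>N\<close> periods because the Bessel inequality below is applied to functions
  supported in an interval longer than one period.\<close>

lemma parseval_trig_polynomial:
  assumes T: "0 < T" "1 \<le> N" and K: "finite K"
  shows "integral {u..u + real N * T} (\<lambda>x. (cmod (\<Sum>k\<in>K. c k * cis (2 * pi * of_int k * x / T)))\<^sup>2)
    = real N * T * (\<Sum>k\<in>K. (cmod (c k))\<^sup>2)"
proof -
  let ?e = "\<lambda>k x. cis (2 * pi * of_int k * x / T)"
  have ei: "?e m integrable_on {u..v}" for m u v
    using T by (intro integrable_continuous_real continuous_intros) auto
  have ee: "?e (k - j) x = ?e k x * cnj (?e j x)" for k j x
    by (simp add: cis_cnj cis_mult diff_divide_distrib algebra_simps)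
  have "complex_of_real ((cmod (\<Sum>k\<in>K. c k * ?e k x))\<^sup>2) = (\<Sum>k\<in>K. \<Sum>j\<in>K. c k * cnj (c j) * ?e (k - j) x)" for x
    unfolding complex_norm_square cnj_sum sum_product
    by (intro sum.cong refl) (subst ee, simp only: complex_cnj_mult mult_ac)
  then have "complex_of_real (integral {u..u + real N * T} (\<lambda>x. (cmod (\<Sum>k\<in>K. c k * ?e k x))\<^sup>2))
      = integral {u..u + real N * T} (\<lambda>x. \<Sum>k\<in>K. \<Sum>j\<in>K. c k * cnj (c j) * ?e (k - j) x)"
    by (subst integral_of_real_complex[symmetric])
      (use T in \<open>auto intro!: integrable_continuous_real continuous_intros\<close>)
  also have "\<dots> = (\<Sum>k\<in>K. \<Sum>j\<in>K. c k * cnj (c j) * integral {u..u + real N * T} (?e (k - j)))"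
    by (subst integral_sum[OF K], intro integrable_sum K integrable_on_mult_right ei, intro sum.cong refl,
      subst integral_sum[OF K], intro integrable_on_mult_right ei)
      (simp only: Henstock_Kurzweil_Integration.integral_mult_right)
  also have "\<dots> = (\<Sum>k\<in>K. \<Sum>j\<in>K. if j = k then c k * cnj (c k) * of_real (real N * T) else 0)"
    by (intro sum.cong refl) (auto simp: integral_cis[OF T] simp del: of_int_diff)
  also have "\<dots> = of_real (real N * T * (\<Sum>k\<in>K. (cmod (c k))\<^sup>2))"
    using K by (simp add: complex_norm_square[symmetric] sum_distrib_left mult_ac)
  finally show ?thesis by (simp only: of_real_eq_iff)
qed

lemma cis_borel_measurable_lebesgue: "(\<lambda>x. cis (c * x)) \<in> borel_measurable lebesgue"
proof -
  have "(\<lambda>x. cis (c * x)) \<in> borel_measurable borel"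
    by (intro borel_measurable_continuous_onI continuous_intros)
  then show ?thesis by (simp add: measurable_completion)
qed

text \<open>Let \<open>c\<^sub>k\<close> be the integrals on the left, \<open>p = \<Sum>\<^sub>k c\<^sub>k e\<^sub>k\<close>, \<open>s = \<Sum>\<^sub>k |c\<^sub>k|\<^sup>2\<close> and \<open>\<mu> = N T\<close>. Then \<open>h\<close> pairs with \<open>p\<close> to
  \<open>s\<close>, and the integral of \<open>|p|\<^sup>2\<close> is \<open>\<mu> s\<close>, so integrating \<open>2 Re (h p\<^sup>*) \<le> \<mu> |h|\<^sup>2 + |p|\<^sup>2 / \<mu>\<close> gives
  \<open>2 s \<le> \<mu> \<parallel>h\<parallel>\<^sup>2 + s\<close>.\<close>

lemma bessel_inequality:
  assumes h: "h \<in> L2" and supp: "\<And>x. x \<notin> {u..u + real N * T} \<Longrightarrow> h x = 0"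
    and T: "0 < T" "1 \<le> N" and K: "finite K"
  shows "(\<Sum>k\<in>K. (cmod (LINT x|lebesgue. h x * cis (- (2 * pi * of_int k * x / T))))\<^sup>2)
     \<le> real N * T * (LINT x|lebesgue. (cmod (h x))\<^sup>2)"
proof -
  define \<mu> where "\<mu> = real N * T"
  have \<mu>: "0 < \<mu>" using T by (simp add: \<mu>_def)
  define e where "e k x = cis (2 * pi * of_int k * x / T)" for k x
  have ce: "cnj (e k x) = cis (- (2 * pi * of_int k * x / T))" for k x by (simp add: e_def cis_cnj)
  define c where "c k = (LINT x|lebesgue. h x * cnj (e k x))" for k
  define p where "p x = (\<Sum>k\<in>K. c k * e k x)" for x
  define s where "s = (\<Sum>k\<in>K. (cmod (c k))\<^sup>2)"
  have hk: "integrable lebesgue (\<lambda>x. h x * cnj (e k x))" for k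
  proof (rule integrable_L2_bounded_support)
    have "(\<lambda>x. cnj (e k x)) \<in> borel_measurable lebesgue"
      using cis_borel_measurable_lebesgue[of "- (2 * pi * of_int k / T)"] by (simp add: ce)
    then show "(\<lambda>x. h x * cnj (e k x)) \<in> L2"
      by (intro L2_mult_bounded[OF h, of _ 1]) (auto simp: e_def)
  qed (use supp in auto)
  have hp: "h x * cnj (p x) = (\<Sum>k\<in>K. cnj (c k) * (h x * cnj (e k x)))" for x
    by (simp add: p_def cnj_sum sum_distrib_left mult_ac)
  have hpi: "integrable lebesgue (\<lambda>x. h x * cnj (p x))"
    unfolding hp by (intro Bochner_Integration.integrable_sum integrable_mult_right hk)
  have "(LINT x|lebesgue. h x * cnj (p x)) = (\<Sum>k\<in>K. cnj (c k) * c k)"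
    unfolding hp by (subst Bochner_Integration.integral_sum) (auto simp: hk c_def)
  also have "\<dots> = of_real s" by (simp add: s_def complex_norm_square[symmetric] mult.commute)
  finally have s1: "(LINT x|lebesgue. Re (h x * cnj (p x))) = s"
    using integral_Re[OF hpi] by simp
  have pc: "continuous_on A p" for A unfolding p_def e_def using T by (intro continuous_intros) auto
  have pcc: "continuous_on {u..u + \<mu>} (\<lambda>x. (cmod (p x))\<^sup>2)" by (intro continuous_intros pc)
  define P where "P x = indicator {u..u + \<mu>} x *\<^sub>R (cmod (p x))\<^sup>2" for x
  have pi: "integrable lebesgue P" and pI: "(LINT x|lebesgue. P x) = \<mu> * s"
    using integral_lebesgue_continuous[OF pcc] parseval_trig_polynomial[OF T K, of u c]
    by (auto simp: P_def[abs_def] p_def e_def s_def \<mu>_def)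
  have "2 * s = (LINT x|lebesgue. 2 * Re (h x * cnj (p x)))" by (simp only: integral_mult_right_zero s1)
  also have "\<dots> \<le> (LINT x|lebesgue. \<mu> * (cmod (h x))\<^sup>2 + (1 / \<mu>) * P x)"
  proof (rule integral_mono)
    show "integrable lebesgue (\<lambda>x. 2 * Re (h x * cnj (p x)))" by (intro integrable_mult_right integrable_Re hpi)
    show "integrable lebesgue (\<lambda>x. \<mu> * (cmod (h x))\<^sup>2 + (1 / \<mu>) * P x)"
      using h pi by (intro Bochner_Integration.integrable_add integrable_mult_right) (auto simp: L2_def)
    fix x
    show "2 * Re (h x * cnj (p x)) \<le> \<mu> * (cmod (h x))\<^sup>2 + (1 / \<mu>) * P x"
    proof (cases "x \<in> {u..u + \<mu>}")
      case False then show ?thesis using supp[of x] by (simp add: \<mu>_def P_def)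
    next
      case True
      have "Re (h x * cnj (p x)) \<le> cmod (h x) * cmod (p x)"
        using complex_Re_le_cmod[of "h x * cnj (p x)"] by (simp add: norm_mult)
      moreover have "0 \<le> (\<mu> * cmod (h x) - cmod (p x))\<^sup>2 / \<mu>" using \<mu> by simp
      moreover have "(\<mu> * cmod (h x) - cmod (p x))\<^sup>2 / \<mu> = \<mu> * (cmod (h x))\<^sup>2 + (1 / \<mu>) * (cmod (p x))\<^sup>2 - 2 * (cmod (h x) * cmod (p x))"
        using \<mu> by (simp add: power2_eq_square field_simps)
      ultimately show ?thesis using True by (simp add: P_def)
    qed
  qed
  also have "\<dots> = \<mu> * (LINT x|lebesgue. (cmod (h x))\<^sup>2) + (1 / \<mu>) * (\<mu> * s)"
    using h pi by (subst Bochner_Integration.integral_add) (auto simp: L2_def pI)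
  also have "\<dots> = \<mu> * (LINT x|lebesgue. (cmod (h x))\<^sup>2) + s" using \<mu> by simp
  finally show ?thesis by (simp add: s_def c_def ce \<mu>_def)
qed

text \<open>Generation by sums of monomials makes closure under products a matter of two inductions;
  \<open>trig_polynomial_sum\<close> recovers the usual form.\<close>

inductive trig_polynomial :: "(real \<Rightarrow> complex) \<Rightarrow> bool" where
  monomial: "trig_polynomial (\<lambda>t. c * cis (of_int k * t))"
| add: "trig_polynomial f \<Longrightarrow> trig_polynomial g \<Longrightarrow> trig_polynomial (\<lambda>t. f t + g t)"

lemma trig_polynomial_mult:
  assumes "trig_polynomial f" "trig_polynomial g" shows "trig_polynomial (\<lambda>t. f t * g t)"
  using assms(1)
proof induction
  case (monomial c k)
  show ?case using assms(2)
  proof induction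
    case (monomial d j)
    have "(\<lambda>t. c * cis (of_int k * t) * (d * cis (of_int j * t))) = (\<lambda>t. c * d * cis (of_int (k + j) * t))"
      by (simp add: fun_eq_iff distrib_right cis_mult[symmetric] del: of_int_mult)
    then show ?case using trig_polynomial.monomial[of "c * d" "k + j"] by simp
  qed (simp add: distrib_left trig_polynomial.add)
qed (simp add: distrib_right trig_polynomial.add)

lemma trig_polynomial_const: "trig_polynomial (\<lambda>t. c)"
  using trig_polynomial.monomial[of c 0] by simp

lemma trig_polynomial_sum:
  assumes "trig_polynomial f"
  obtains K d where "finite K" "\<And>t. f t = (\<Sum>k\<in>K. d k * cis (of_int k * t))"
  using assms
proof (induction arbitrary: thesis)
  case (monomial c k)
  show ?case by (rule monomial[of "{k}" "\<lambda>_. c"]) auto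
next
  case (add f g)
  obtain K d where K: "finite K" "\<And>t. f t = (\<Sum>k\<in>K. d k * cis (of_int k * t))" using add.IH(1) by blast
  obtain J b where J: "finite J" "\<And>t. g t = (\<Sum>k\<in>J. b k * cis (of_int k * t))" using add.IH(2) by blast
  show ?case
  proof (rule add.prems)
    show "finite (K \<union> J)" using K J by simp
    fix t
    have "f t = (\<Sum>k\<in>K \<union> J. (if k \<in> K then d k else 0) * cis (of_int k * t))"
      unfolding K(2) using K(1) J(1) by (intro sum.mono_neutral_cong_left) auto
    moreover have "g t = (\<Sum>k\<in>K \<union> J. (if k \<in> J then b k else 0) * cis (of_int k * t))"
      unfolding J(2) using K(1) J(1) by (intro sum.mono_neutral_cong_left) auto
    ultimately show "f t + g t = (\<Sum>k\<in>K \<union> J. ((if k \<in> K then d k else 0) + (if k \<in> J then b k else 0)) * cis (of_int k * t))"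
      by (simp add: sum.distrib distrib_right)
  qed
qed

lemma trig_polynomial_real_polynomial:
  fixes p :: "complex \<Rightarrow> real"
  assumes "real_polynomial_function p"
  shows "trig_polynomial (\<lambda>t. of_real (p (cis t)))"
  using assms
proof induction
  case (linear f)
  have "f (cis t) = cos t * f 1 + sin t * f \<i>" for t
  proof -
    have "cis t = cos t *\<^sub>R 1 + sin t *\<^sub>R \<i>" by (simp add: complex_eq_iff)
    then show ?thesis by (simp add: linear_add linear_cmul bounded_linear.linear[OF linear])
  qed
  moreover have "complex_of_real (cos t) = 1/2 * cis (of_int 1 * t) + 1/2 * cis (of_int (-1) * t)" for t
    by (simp add: complex_eq_iff)
  moreover have "complex_of_real (sin t) = - \<i>/2 * cis (of_int 1 * t) + \<i>/2 * cis (of_int (-1) * t)" for t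
    by (simp add: complex_eq_iff)
  ultimately have "(\<lambda>t. complex_of_real (f (cis t))) =
    (\<lambda>t. (1/2 * cis (of_int 1 * t) + 1/2 * cis (of_int (-1) * t)) * of_real (f 1) +
         (- \<i>/2 * cis (of_int 1 * t) + \<i>/2 * cis (of_int (-1) * t)) * of_real (f \<i>))"
    by (simp only: of_real_add of_real_mult)
  then show ?case
    by (simp only:) (intro trig_polynomial.intros trig_polynomial_mult trig_polynomial_const)
next
  case (mult f g) then show ?case by (simp add: trig_polynomial_mult)
qed (auto simp: trig_polynomial_const trig_polynomial.add)

text \<open>A periodic function is a function on the circle, where the Stone-Weierstrass theorem gives
  approximation by polynomials in the real and imaginary part, and these are trigonometric
  polynomials in the angle. The function on the circle is continuous because the interval
  \<open>[0, 2\<pi>]\<close> is compact: preimages of closed sets are images of compact sets.\<close>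

lemma trig_approximation:
  fixes f :: "real \<Rightarrow> complex"
  assumes T: "0 < T" and cont: "continuous_on UNIV f" and per: "\<And>x. f (x + T) = f x" and "0 < \<epsilon>"
  obtains K d where "finite K" "\<And>x. cmod (f x - (\<Sum>k\<in>K. d k * cis (2 * pi * of_int k * x / T))) < \<epsilon>"
proof -
  have per_nat: "f (x + real n * T) = f x" for x n
  proof (induction n)
    case (Suc n)
    then show ?case using per[of "x + real n * T"] by (simp add: algebra_simps)
  qed simp
  have per_int: "f (x + of_int n * T) = f x" for x n
    using per_nat[of x "nat n"] per_nat[of "x + of_int n * T" "nat (- n)"] by (cases "0 \<le> n") auto
  define F where "F z = f (T * Arg z / (2 * pi))" for z
  have Fcis: "F (cis t) = f (T * t / (2 * pi))" for t
  proof -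
    have "cis (Arg (cis t)) = cis t" using cis_Arg[of "cis t"] by (simp add: sgn_div_norm)
    then obtain n :: int where "Arg (cis t) = t + 2 * pi * of_int n"
      using sin_cos_eq_iff[of "Arg (cis t)" t] by (auto simp: complex_eq_iff)
    then have "T * Arg (cis t) / (2 * pi) = T * t / (2 * pi) + of_int n * T" by (simp add: field_simps)
    then show ?thesis using per_int by (simp add: F_def)
  qed
  have sph: "sphere 0 1 = cis ` {0..2 * pi}"
  proof
    show "sphere 0 1 \<subseteq> cis ` {0..2 * pi}"
    proof
      fix z :: complex assume "z \<in> sphere 0 1"
      then have "z = cis (Arg2pi z)" using Arg2pi_eq[of z] by (simp add: cis_conv_exp)
      then show "z \<in> cis ` {0..2 * pi}" using Arg2pi[of z] by (intro image_eqI[of _ _ "Arg2pi z"]) auto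
    qed
  qed auto
  have "continuous_on (sphere 0 1) F"
    unfolding continuous_on_closed_vimage[OF closed_sphere]
  proof (intro allI impI)
    fix B :: "complex set" assume B: "closed B"
    have eq: "F -` B \<inter> sphere 0 1 = cis ` ({0..2 * pi} \<inter> (\<lambda>t. f (T * t / (2 * pi))) -` B)"
      unfolding sph using Fcis by auto
    have "continuous_on {0..2 * pi} (\<lambda>t. f (T * t / (2 * pi)))"
      by (intro continuous_on_compose2[OF cont] continuous_intros) auto
    then have "closed ({0..2 * pi} \<inter> (\<lambda>t. f (T * t / (2 * pi))) -` B)"
      using B by (intro continuous_closed_preimage) auto
    then have "compact ({0..2 * pi} \<inter> (\<lambda>t. f (T * t / (2 * pi))) -` B)"
      by (metis compact_Icc compact_Int_closed inf.left_idem)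
    then have "compact (cis ` ({0..2 * pi} \<inter> (\<lambda>t. f (T * t / (2 * pi))) -` B))"
      by (intro compact_continuous_image continuous_intros)
    then show "closed (F -` B \<inter> sphere 0 1)" unfolding eq by (rule compact_imp_closed)
  qed
  then obtain g where g: "polynomial_function g" "\<And>z. z \<in> sphere 0 1 \<Longrightarrow> cmod (F z - g z) < \<epsilon>"
    using Stone_Weierstrass_polynomial_function[OF compact_sphere _ \<open>0 < \<epsilon>\<close>, of 0 1 F] by blast
  have "real_polynomial_function (Re \<circ> g)" "real_polynomial_function (Im \<circ> g)"
    using g(1) bounded_linear_Re bounded_linear_Im by (auto simp: polynomial_function_def)
  from this[THEN trig_polynomial_real_polynomial]
  have "trig_polynomial (\<lambda>t. of_real (Re (g (cis t))) + \<i> * of_real (Im (g (cis t))))"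
    by (intro trig_polynomial.add trig_polynomial_mult trig_polynomial_const) (auto simp: o_def)
  then have "trig_polynomial (\<lambda>t. g (cis t))" by (simp add: complex_eq[symmetric])
  then obtain K d where K: "finite K" "\<And>t. g (cis t) = (\<Sum>k\<in>K. d k * cis (of_int k * t))"
    by (rule trig_polynomial_sum) blast
  show thesis
  proof (rule that[OF K(1)])
    fix x
    have "cmod (F (cis (2 * pi * x / T)) - g (cis (2 * pi * x / T))) < \<epsilon>" by (intro g(2)) simp
    then show "cmod (f x - (\<Sum>k\<in>K. d k * cis (2 * pi * of_int k * x / T))) < \<epsilon>"
      using T by (simp add: K(2) Fcis mult_ac)
  qed
qed

text \<open>The nontrivial half of Parseval's identity. By the best approximation property, the defect between
  the two sides is at most \<open>T\<close> times the squared distance of \<open>f\<close> from any trigonometric polynomial.\<close>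

lemma parseval_continuous_periodic:
  fixes f :: "real \<Rightarrow> complex"
  assumes T: "0 < T" and cont: "continuous_on UNIV f" and per: "\<And>x. f (x + T) = f x" and "0 < \<epsilon>"
  obtains K where "finite K"
    "T * integral {0..T} (\<lambda>x. (cmod (f x))\<^sup>2)
      \<le> (\<Sum>k\<in>K. (cmod (integral {0..T} (\<lambda>x. f x * cis (- (2 * pi * of_int k * x / T)))))\<^sup>2) + \<epsilon>"
proof -
  define \<eta> where "\<eta> = sqrt \<epsilon> / T"
  have \<eta>: "0 < \<eta>" using T \<open>0 < \<epsilon>\<close> by (simp add: \<eta>_def)
  define e where "e k x = cis (2 * pi * of_int k * x / T)" for k x
  obtain K d where K: "finite K" and d: "\<And>x. cmod (f x - (\<Sum>k\<in>K. d k * e k x)) < \<eta>"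
    using trig_approximation[OF T cont per \<eta>] unfolding e_def by blast
  define p where "p x = (\<Sum>k\<in>K. d k * e k x)" for x
  define c where "c k = integral {0..T} (\<lambda>x. f x * cnj (e k x))" for k
  have ce: "cnj (e k x) = cis (- (2 * pi * of_int k * x / T))" for k x by (simp add: e_def cis_cnj)
  have fc: "continuous_on A f" for A using cont by (rule continuous_on_subset) simp
  have ec: "continuous_on A (e k)" for A k unfolding e_def using T by (intro continuous_intros) auto
  have pc: "continuous_on A p" for A unfolding p_def by (intro continuous_intros ec)
  have int: "g integrable_on {0..T}" if "continuous_on {0..T} g" for g :: "real \<Rightarrow> 'a::banach"
    using that by (rule integrable_continuous_real)
  have "integral {0..T} (\<lambda>x. f x * cnj (p x)) = integral {0..T} (\<lambda>x. \<Sum>k\<in>K. cnj (d k) * (f x * cnj (e k x)))"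
    by (simp add: p_def cnj_sum sum_distrib_left mult_ac)
  also have "\<dots> = (\<Sum>k\<in>K. cnj (d k) * c k)"
    using K unfolding c_def
    by (subst integral_sum) (auto intro!: int continuous_intros fc ec)
  finally have fp: "integral {0..T} (\<lambda>x. Re (f x * cnj (p x))) = (\<Sum>k\<in>K. Re (cnj (d k) * c k))"
  proof -
    assume *: "integral {0..T} (\<lambda>x. f x * cnj (p x)) = (\<Sum>k\<in>K. cnj (d k) * c k)"
    have "(\<lambda>x. f x * cnj (p x)) integrable_on {0..T}" by (intro int continuous_intros fc pc)
    then have "Re (integral {0..T} (\<lambda>x. f x * cnj (p x))) = integral {0..T} (\<lambda>x. Re (f x * cnj (p x)))"
      using integral_linear[OF _ bounded_linear_Re] by (fastforce simp: o_def)
    then show ?thesis unfolding * by (simp only: Re_sum)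
  qed
  have pp: "integral {0..T} (\<lambda>x. (cmod (p x))\<^sup>2) = T * (\<Sum>k\<in>K. (cmod (d k))\<^sup>2)"
    using parseval_trig_polynomial[OF T _ K, of 1 0 d] by (simp add: p_def e_def)
  have sq: "(cmod (z - w))\<^sup>2 = (cmod z)\<^sup>2 - 2 * Re (z * cnj w) + (cmod w)\<^sup>2" for z w
    unfolding cmod_power2 by (simp add: power2_eq_square algebra_simps)
  have "integral {0..T} (\<lambda>x. (cmod (f x - p x))\<^sup>2)
      = integral {0..T} (\<lambda>x. (cmod (f x))\<^sup>2) - 2 * (\<Sum>k\<in>K. Re (cnj (d k) * c k)) + T * (\<Sum>k\<in>K. (cmod (d k))\<^sup>2)"
  proof -
    have "integral {0..T} (\<lambda>x. (cmod (f x - p x))\<^sup>2)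
       = integral {0..T} (\<lambda>x. (cmod (f x))\<^sup>2 - 2 * Re (f x * cnj (p x))) + integral {0..T} (\<lambda>x. (cmod (p x))\<^sup>2)"
      unfolding sq by (intro Henstock_Kurzweil_Integration.integral_add int continuous_intros fc pc)
    also have "integral {0..T} (\<lambda>x. (cmod (f x))\<^sup>2 - 2 * Re (f x * cnj (p x)))
       = integral {0..T} (\<lambda>x. (cmod (f x))\<^sup>2) - integral {0..T} (\<lambda>x. 2 * Re (f x * cnj (p x)))"
      by (intro Henstock_Kurzweil_Integration.integral_diff int continuous_intros fc pc)
    also have "integral {0..T} (\<lambda>x. 2 * Re (f x * cnj (p x))) = 2 * (\<Sum>k\<in>K. Re (cnj (d k) * c k))"
      by (simp only: Henstock_Kurzweil_Integration.integral_mult_right fp)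
    finally show ?thesis by (simp only: pp)
  qed
  moreover have "2 * Re (cnj (d k) * c k) \<le> T * (cmod (d k))\<^sup>2 + (cmod (c k))\<^sup>2 / T" for k
  proof -
    have "Re (cnj (d k) * c k) \<le> cmod (d k) * cmod (c k)"
      using complex_Re_le_cmod[of "cnj (d k) * c k"] by (simp add: norm_mult)
    moreover have "0 \<le> (T * cmod (d k) - cmod (c k))\<^sup>2 / T" using T by simp
    moreover have "(T * cmod (d k) - cmod (c k))\<^sup>2 / T = T * (cmod (d k))\<^sup>2 + (cmod (c k))\<^sup>2 / T - 2 * (cmod (d k) * cmod (c k))"
      using T by (simp add: power2_eq_square field_simps)
    ultimately show ?thesis by linarith
  qed
  then have "(\<Sum>k\<in>K. 2 * Re (cnj (d k) * c k)) \<le> (\<Sum>k\<in>K. T * (cmod (d k))\<^sup>2 + (cmod (c k))\<^sup>2 / T)"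
    by (rule sum_mono)
  then have "2 * (\<Sum>k\<in>K. Re (cnj (d k) * c k)) \<le> T * (\<Sum>k\<in>K. (cmod (d k))\<^sup>2) + (\<Sum>k\<in>K. (cmod (c k))\<^sup>2) / T"
    by (simp only: sum_distrib_left sum.distrib sum_divide_distrib)
  moreover have "integral {0..T} (\<lambda>x. (cmod (f x - p x))\<^sup>2) \<le> integral {0..T} (\<lambda>x. \<eta>\<^sup>2)"
    using d by (intro integral_le int continuous_intros fc pc power_mono) (auto simp: p_def intro: less_imp_le)
  then have "integral {0..T} (\<lambda>x. (cmod (f x - p x))\<^sup>2) \<le> T * \<eta>\<^sup>2" using T by simp
  ultimately have "integral {0..T} (\<lambda>x. (cmod (f x))\<^sup>2) \<le> (\<Sum>k\<in>K. (cmod (c k))\<^sup>2) / T + T * \<eta>\<^sup>2" by linarith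
  then have "T * integral {0..T} (\<lambda>x. (cmod (f x))\<^sup>2) \<le> T * ((\<Sum>k\<in>K. (cmod (c k))\<^sup>2) / T + T * \<eta>\<^sup>2)"
    using T by (intro mult_left_mono) auto
  also have "\<dots> = (\<Sum>k\<in>K. (cmod (c k))\<^sup>2) + \<epsilon>"
    using T \<open>0 < \<epsilon>\<close> by (simp add: \<eta>_def field_simps power2_eq_square)
  finally show thesis using that[OF K] by (simp add: c_def ce)
qed

section \<open>Periodization\<close>

lemma sum_integral_adjacent:
  fixes F :: "real \<Rightarrow> 'b::euclidean_space"
  assumes "continuous_on UNIV F" "0 < T"
  shows "(\<Sum>i<N. integral {u + real i * T..u + real (Suc i) * T} F) = integral {u..u + real N * T} F"
proof (induction N)
  case (Suc N)
  have "integral {u..u + real N * T} F + integral {u + real N * T..u + real (Suc N) * T} F = integral {u..u + real (Suc N) * T} F"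
    using assms by (intro Henstock_Kurzweil_Integration.integral_combine integrable_continuous_real continuous_on_subset[OF assms(1)])
      (auto simp: algebra_simps)
  then show ?case using Suc by simp
qed simp

lemma integral_fold_period:
  fixes F :: "real \<Rightarrow> 'b::euclidean_space"
  assumes F: "continuous_on UNIV F" and T: "0 < T" and supp: "\<And>x. real L * T < \<bar>x\<bar> \<Longrightarrow> F x = 0"
  shows "(LINT x|lebesgue. F x) = integral {0..T} (\<lambda>x. \<Sum>l\<in>{- int L..int L}. F (x + T * of_int l))"
proof -
  define u where "u = - (real L * T)"
  have Fc: "continuous_on A F" for A using F by (rule continuous_on_subset) simp
  have shift: "integral {0..T} (\<lambda>x. F (x + c)) = integral {c..c + T} F" for c
    using integral_shift_Icc_real[of 0 T F c] by (simp add: o_def add.commute)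
  have "(LINT x|lebesgue. F x) = (LINT x|lebesgue. indicator {u..u + real (2 * L + 1) * T} x *\<^sub>R F x)"
  proof (rule Bochner_Integration.integral_cong[OF refl])
    fix x
    show "F x = indicator {u..u + real (2 * L + 1) * T} x *\<^sub>R F x"
      using supp[of x] T by (cases "real L * T < \<bar>x\<bar>") (auto simp: indicator_def u_def algebra_simps abs_if split: if_splits)
  qed
  also have "\<dots> = integral {u..u + real (2 * L + 1) * T} F"
    by (intro integral_lebesgue_continuous Fc)
  also have "\<dots> = (\<Sum>i<2 * L + 1. integral {u + real i * T..u + real (Suc i) * T} F)"
    by (rule sum_integral_adjacent[OF F T, symmetric])
  also have "\<dots> = (\<Sum>l\<in>{- int L..int L}. integral {T * of_int l..T * of_int l + T} F)"
    by (rule sum.reindex_bij_witness[of _ "\<lambda>l. nat (l + int L)" "\<lambda>i. int i - int L"])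
      (auto simp: u_def algebra_simps)
  also have "\<dots> = (\<Sum>l\<in>{- int L..int L}. integral {0..T} (\<lambda>x. F (x + T * of_int l)))"
    by (simp only: shift)
  also have "\<dots> = integral {0..T} (\<lambda>x. \<Sum>l\<in>{- int L..int L}. F (x + T * of_int l))"
    by (intro Henstock_Kurzweil_Integration.integral_sum[symmetric] integrable_continuous_real continuous_on_compose2[OF F] continuous_intros) auto
  finally show ?thesis .
qed

text \<open>The parameter \<open>R\<close> bounds the support of \<open>h\<close>. It is recorded in the index set so that the sum is
  finite at every point.\<close>

definition periodization :: "real \<Rightarrow> real \<Rightarrow> (real \<Rightarrow> complex) \<Rightarrow> real \<Rightarrow> complex" where
  "periodization T R h x = (\<Sum>l | \<bar>x - T * of_int l\<bar> \<le> R. h (x - T * of_int l))"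

lemma periodization_eq:
  assumes "finite S" "\<And>l. \<bar>x - T * of_int l\<bar> \<le> R \<Longrightarrow> l \<in> S" "\<And>x. R < \<bar>x\<bar> \<Longrightarrow> h x = 0"
  shows "periodization T R h x = (\<Sum>l\<in>S. h (x - T * of_int l))"
  unfolding periodization_def using assms by (intro sum.mono_neutral_left) (auto simp: not_le)

lemma periodization_periodic: "periodization T R h (x + T) = periodization T R h x"
  unfolding periodization_def
  by (rule sum.reindex_bij_witness[of _ "\<lambda>l. l + 1" "\<lambda>l. l - 1"]) (auto simp: algebra_simps)

lemma continuous_periodization:
  assumes T: "0 < T" and h: "continuous_on UNIV h" and supp: "\<And>x. R < \<bar>x\<bar> \<Longrightarrow> h x = 0" and R: "0 \<le> R"
  shows "continuous_on UNIV (periodization T R h)"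
proof -
  have cont: "continuous_on {y - 1<..<y + 1} (periodization T R h)" for y
  proof -
    define S where "S = {l::int. \<bar>y - T * of_int l\<bar> \<le> R + 1}"
    have fin: "finite S" unfolding S_def using T R by (intro card_lattice_interval) auto
    have "continuous_on {y - 1<..<y + 1} (\<lambda>x. \<Sum>l\<in>S. h (x - T * of_int l))"
      by (intro continuous_intros continuous_on_compose2[OF h]) auto
    then show ?thesis
    proof (rule continuous_on_eq)
      fix x assume x: "x \<in> {y - 1<..<y + 1}"
      have "l \<in> S" if "\<bar>x - T * of_int l\<bar> \<le> R" for l
        using that x by (auto simp: S_def abs_if split: if_splits)
      then show "(\<Sum>l\<in>S. h (x - T * of_int l)) = periodization T R h x"
        using periodization_eq[OF fin _ supp] by simp
    qed
  qed
  have "isCont (periodization T R h) y" for y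
    by (rule bspec[OF iffD1[OF continuous_on_eq_continuous_at[OF open_greaterThanLessThan] cont[of y]]]) simp
  then show ?thesis by (simp add: continuous_at_imp_continuous_on)
qed

section \<open>Upper frame bound\<close>

definition gabor_coefficient ::
  "(real \<Rightarrow> real) \<Rightarrow> real \<Rightarrow> real \<Rightarrow> (real \<Rightarrow> complex) \<Rightarrow> int \<times> int \<Rightarrow> complex" where
  "gabor_coefficient g a T f = (\<lambda>(j, m). LINT x|lebesgue.
     f x * of_real (g (x - a * of_int m)) * cis (- (2 * pi * of_int j * x / T)))"

lemma gabor_coefficient_eq_inner:
  "gabor_coefficient g a T f i = L2_inner f (gabor_system (\<lambda>x. of_real (g x)) a (1 / T) i)"
proof -
  obtain j m where i: "i = (j, m)" by (cases i)
  have "exp (2 * of_real pi * \<i> * of_real (1 / T * of_int j * x)) = cis (2 * pi * of_int j * x / T)" for x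
    by (simp add: cis_conv_exp mult_ac)
  then show ?thesis unfolding i gabor_coefficient_def L2_inner_def gabor_system_def
    by (simp add: cis_cnj mult_ac)
qed

lemma measurable_shift_lebesgue:
  fixes g :: "real \<Rightarrow> real"
  assumes "continuous_on UNIV g"
  shows "(\<lambda>x. complex_of_real (g (x - c))) \<in> borel_measurable lebesgue"
proof -
  have "(\<lambda>x. complex_of_real (g (x - c))) \<in> borel_measurable borel"
    by (intro borel_measurable_continuous_onI continuous_intros continuous_on_compose2[OF assms]) auto
  then show ?thesis by (simp add: measurable_completion)
qed

text \<open>Both frame directions rest on this estimate: with crude bounds it is the upper frame bound, and
  for functions living where the spline is small it contradicts the lower one. For each \<open>m\<close> it is
  the Bessel inequality for \<open>f g(\<cdot> - a m)\<close>.\<close>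

lemma gabor_sum_le:
  assumes f: "f \<in> L2" and T: "0 < T" "1 \<le> N"
    and g: "continuous_on UNIV g" "\<And>x. \<bar>g x\<bar> \<le> C"
    and supp: "\<And>m x. f x \<noteq> 0 \<Longrightarrow> g (x - a * of_int m) \<noteq> 0 \<Longrightarrow> x \<in> {u m..u m + real N * T}"
    and B: "\<And>x M. f x \<noteq> 0 \<Longrightarrow> finite M \<Longrightarrow> (\<Sum>m\<in>M. (g (x - a * of_int m))\<^sup>2) \<le> B"
    and \<Omega>: "finite \<Omega>"
  shows "(\<Sum>i\<in>\<Omega>. (cmod (gabor_coefficient g a T f i))\<^sup>2) \<le> real N * T * B * (LINT x|lebesgue. (cmod (f x))\<^sup>2)"
proof -
  define h where "h m x = f x * of_real (g (x - a * of_int m))" for m :: int and x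
  have hL2: "h m \<in> L2" for m
    unfolding h_def using f measurable_shift_lebesgue[OF g(1)] g(2)
    by (intro L2_mult_bounded[of _ _ C]) auto
  have hi: "integrable lebesgue (\<lambda>x. (cmod (h m x))\<^sup>2)" for m using hL2 by (simp add: L2_def)
  have "(\<Sum>i\<in>\<Omega>. (cmod (gabor_coefficient g a T f i))\<^sup>2)
      \<le> (\<Sum>i\<in>fst ` \<Omega> \<times> snd ` \<Omega>. (cmod (gabor_coefficient g a T f i))\<^sup>2)"
    using \<Omega> subset_fst_snd by (intro sum_mono2) auto
  also have "\<dots> = (\<Sum>m\<in>snd ` \<Omega>. \<Sum>j\<in>fst ` \<Omega>. (cmod (gabor_coefficient g a T f (j, m)))\<^sup>2)"
    unfolding sum.cartesian_product' by (rule sum.swap)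
  also have "\<dots> \<le> (\<Sum>m\<in>snd ` \<Omega>. real N * T * (LINT x|lebesgue. (cmod (h m x))\<^sup>2))"
  proof (rule sum_mono)
    fix m assume "m \<in> snd ` \<Omega>"
    show "(\<Sum>j\<in>fst ` \<Omega>. (cmod (gabor_coefficient g a T f (j, m)))\<^sup>2) \<le> real N * T * (LINT x|lebesgue. (cmod (h m x))\<^sup>2)"
      unfolding gabor_coefficient_def prod.case h_def[symmetric]
      using supp by (intro bessel_inequality[OF hL2 _ T, where u = "u m"]) (auto simp: h_def \<Omega>)
  qed
  also have "\<dots> = real N * T * (LINT x|lebesgue. (\<Sum>m\<in>snd ` \<Omega>. (cmod (h m x))\<^sup>2))"
    by (simp add: Bochner_Integration.integral_sum[OF hi] sum_distrib_left)
  also have "\<dots> \<le> real N * T * (LINT x|lebesgue. B * (cmod (f x))\<^sup>2)"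
  proof (intro mult_left_mono integral_mono)
    show "integrable lebesgue (\<lambda>x. \<Sum>m\<in>snd ` \<Omega>. (cmod (h m x))\<^sup>2)" by (intro Bochner_Integration.integrable_sum hi)
    show "integrable lebesgue (\<lambda>x. B * (cmod (f x))\<^sup>2)" using f by (simp add: L2_def)
    fix x
    show "(\<Sum>m\<in>snd ` \<Omega>. (cmod (h m x))\<^sup>2) \<le> B * (cmod (f x))\<^sup>2"
    proof (cases "f x = 0")
      case False
      have "(\<Sum>m\<in>snd ` \<Omega>. (cmod (h m x))\<^sup>2) = (\<Sum>m\<in>snd ` \<Omega>. (g (x - a * of_int m))\<^sup>2) * (cmod (f x))\<^sup>2"
        unfolding h_def norm_mult power_mult_distrib sum_distrib_right by (simp add: mult.commute)
      also have "\<dots> \<le> B * (cmod (f x))\<^sup>2" using B[OF False] \<Omega> by (intro mult_right_mono) auto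
      finally show ?thesis .
    qed (simp add: h_def)
  qed (use T in auto)
  finally show ?thesis by simp
qed

lemma gabor_coefficient_diff:
  assumes f: "f \<in> L2" "f' \<in> L2" and g: "continuous_on UNIV g" "\<And>x. \<bar>g x\<bar> \<le> C" "\<And>x. R \<le> \<bar>x\<bar> \<Longrightarrow> g x = 0"
  shows "gabor_coefficient g a T (\<lambda>x. f x - f' x) i = gabor_coefficient g a T f i - gabor_coefficient g a T f' i"
proof -
  obtain j m where i: "i = (j, m)" by (cases i)
  have "integrable lebesgue (\<lambda>x. f x * of_real (g (x - a * of_int m)) * cis (- (2 * pi * of_int j * x / T)))" if "f \<in> L2" for f
  proof (rule integrable_L2_bounded_support)
    have c: "(\<lambda>x. cis (- (2 * pi * of_int j * x / T))) \<in> borel_measurable lebesgue"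
      using cis_borel_measurable_lebesgue[of "- (2 * pi * of_int j / T)"] by simp
    show "(\<lambda>x. f x * of_real (g (x - a * of_int m)) * cis (- (2 * pi * of_int j * x / T))) \<in> L2"
      using g(2) by (intro L2_mult_bounded[of _ _ 1] L2_mult_bounded[of _ _ C] c that measurable_shift_lebesgue[OF g(1)]) auto
    show "f x * of_real (g (x - a * of_int m)) * cis (- (2 * pi * of_int j * x / T)) = 0"
      if "x \<notin> {a * of_int m - R..a * of_int m + R}" for x
    proof -
      have "R \<le> \<bar>x - a * of_int m\<bar>" using that by auto
      then show ?thesis using g(3) by simp
    qed
  qed
  from this[OF f(1)] this[OF f(2)] show ?thesis
    unfolding i gabor_coefficient_def by (simp add: left_diff_distrib)
qed

lemma L2_norm_square: "(L2_norm f)\<^sup>2 = (LINT x|lebesgue. (cmod (f x))\<^sup>2)"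
  unfolding L2_norm_def by (intro real_sqrt_pow2 Bochner_Integration.integral_nonneg) simp

lemma gabor_spline_in_L2:
  assumes "1 \<le> k"
  shows "gabor_system (\<lambda>x. complex_of_real (spline k x)) a b i \<in> L2"
proof -
  obtain j m where i: "i = (j, m)" by (cases i)
  obtain C where C: "\<And>x. \<bar>spline k x\<bar> \<le> C" using spline_bounded[OF assms] by blast
  have e: "exp (2 * of_real pi * \<i> * of_real (b * of_int j * x)) = cis (2 * pi * b * of_int j * x)" for x
    by (simp add: cis_conv_exp mult_ac)
  have "(\<lambda>x. complex_of_real (spline k (x - a * of_int m))) \<in> L2"
  proof (rule L2_bounded_support[where C = C])
    show "(\<lambda>x. complex_of_real (spline k (x - a * of_int m))) \<in> borel_measurable lebesgue"
      by (intro measurable_shift_lebesgue continuous_spline assms)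
    show "complex_of_real (spline k (x - a * of_int m)) = 0" if "\<bar>a * of_int m\<bar> + (real k + 1) / 2 < \<bar>x\<bar>" for x
    proof -
      have "(real k + 1) / 2 \<le> \<bar>x - a * of_int m\<bar>" using that by linarith
      then show ?thesis by (simp add: spline_eq_0)
    qed
  qed (simp add: C)
  then have "(\<lambda>x. complex_of_real (spline k (x - a * of_int m)) * cis (2 * pi * b * of_int j * x)) \<in> L2"
    by (rule L2_mult_bounded[of _ _ 1]) (auto intro: cis_borel_measurable_lebesgue)
  then show ?thesis unfolding i gabor_system_def prod.case e by (simp only: mult.commute)
qed

text \<open>At every point at most \<open>(k + 1)/a + 1\<close> translates are nonzero, and the support of each is covered by
  finitely many periods.\<close>

lemma gabor_spline_bessel:
  assumes a: "0 < a" and T: "0 < T" and k: "1 \<le> k"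
  obtains B where "0 < B" "\<And>f \<Omega>. f \<in> L2 \<Longrightarrow> finite \<Omega> \<Longrightarrow>
    (\<Sum>i\<in>\<Omega>. (cmod (gabor_coefficient (spline k) a T f i))\<^sup>2) \<le> B * (LINT x|lebesgue. (cmod (f x))\<^sup>2)"
proof -
  define rad where "rad = (real k + 1) / 2"
  have rad: "0 < rad" by (simp add: rad_def)
  obtain C where C: "\<And>x. \<bar>spline k x\<bar> \<le> C" using spline_bounded[OF k] by blast
  define N where "N = nat \<lceil>2 * rad / T\<rceil>"
  have "2 * rad / T \<le> real N" "0 < 2 * rad / T" using rad T unfolding N_def by (auto intro: real_nat_ceiling_ge)
  then have N: "1 \<le> N" "2 * rad \<le> real N * T" using T by (cases N; force simp: field_simps)+
  define B where "B = C\<^sup>2 * (2 * rad / a + 1)"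
  have B0: "0 \<le> B" unfolding B_def using rad a by (intro mult_nonneg_nonneg) auto
  have supp: "\<bar>y\<bar> < rad" if "spline k y \<noteq> 0" for y
    using spline_eq_0[of k y] that by (force simp: rad_def)
  have sq: "(spline k y)\<^sup>2 \<le> C\<^sup>2" for y using power_mono[OF C[of y], of 2] by simp
  have B: "(\<Sum>m\<in>M. (spline k (x - a * of_int m))\<^sup>2) \<le> B" if "finite M" for x M
  proof -
    let ?I = "{m::int. \<bar>x - a * of_int m\<bar> \<le> rad}"
    have fin: "finite ?I" and card: "real (card ?I) \<le> 2 * rad / a + 1"
      using card_lattice_interval[OF a, of rad x] rad by auto
    have "(\<Sum>m\<in>M. (spline k (x - a * of_int m))\<^sup>2) = (\<Sum>m\<in>M \<inter> ?I. (spline k (x - a * of_int m))\<^sup>2)"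
      using that supp by (intro sum.mono_neutral_right) (auto simp: not_less intro: less_imp_le)
    also have "\<dots> \<le> (\<Sum>m\<in>?I. (spline k (x - a * of_int m))\<^sup>2)" using fin by (intro sum_mono2) auto
    also have "\<dots> \<le> (\<Sum>m\<in>?I. C\<^sup>2)" by (intro sum_mono sq)
    also have "\<dots> \<le> B" using mult_right_mono[OF card, of "C\<^sup>2"] by (simp add: B_def mult.commute)
    finally show ?thesis .
  qed
  show thesis
  proof (rule that)
    have NTB: "0 \<le> real N * T * B" using T B0 by simp
    then show "0 < real N * T * B + 1" by simp
    fix f \<Omega> assume f: "f \<in> L2" and \<Omega>: "finite (\<Omega> :: (int \<times> int) set)"
    have "(\<Sum>i\<in>\<Omega>. (cmod (gabor_coefficient (spline k) a T f i))\<^sup>2) \<le> real N * T * B * (LINT x|lebesgue. (cmod (f x))\<^sup>2)"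
    proof (rule gabor_sum_le[OF f T N(1) continuous_spline[OF k] C _ B \<Omega>])
      fix m x assume "spline k (x - a * of_int m) \<noteq> 0"
      then have "\<bar>x - a * of_int m\<bar> < rad" by (rule supp)
      then show "x \<in> {a * of_int m - rad..a * of_int m - rad + real N * T}" using N(2) by (auto simp: abs_less_iff)
    qed
    also have "\<dots> \<le> (real N * T * B + 1) * (LINT x|lebesgue. (cmod (f x))\<^sup>2)"
      by (intro mult_right_mono Bochner_Integration.integral_nonneg) auto
    finally show "(\<Sum>i\<in>\<Omega>. (cmod (gabor_coefficient (spline k) a T f i))\<^sup>2) \<le> (real N * T * B + 1) * (LINT x|lebesgue. (cmod (f x))\<^sup>2)" .
  qed
qed

section \<open>Lower frame bound\<close>

text \<open>The factorization \<open>F = G H\<close> of generating functions, with \<open>F\<close> the one of the inner sums on the right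
  and \<open>G\<close> the one of \<open>c\<close>. By Parseval, the sum on the right is the mean square of \<open>F\<close> over
  \<open>[-\<pi>, \<pi>]\<close>, and already the part of it over \<open>[-\<pi>/q, \<pi>/q]\<close>, where \<open>|H| \<ge> \<delta>\<close>, gives the bound: this interval
  is a full period of \<open>G\<close>, but only the fraction \<open>1/q\<close> of \<open>[-\<pi>, \<pi>]\<close>, whence the factor \<open>q\<close>.\<close>

lemma fiber_lower_bound:
  fixes c :: "int \<Rightarrow> complex"
  assumes a: "0 < a" and q: "1 \<le> q" and S: "finite S" and M: "finite M"
    and mem: "\<And>l m. l \<in> S \<Longrightarrow> \<bar>x + real q * a * of_int l - a * of_int m\<bar> < (real k + 1) / 2 \<Longrightarrow> m \<in> M"
    and \<delta>: "0 \<le> \<delta>" "\<And>\<phi>. real q * \<bar>\<phi>\<bar> \<le> pi \<Longrightarrow> \<delta> \<le> cmod (modulated_sum a \<phi> k x)"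
  shows "\<delta>\<^sup>2 * (\<Sum>l\<in>S. (cmod (c l))\<^sup>2)
    \<le> real q * (\<Sum>m\<in>M. (cmod (\<Sum>l\<in>S. c l * of_real (spline k (x + real q * a * of_int l - a * of_int m))))\<^sup>2)"
proof -
  define D where "D m = (\<Sum>l\<in>S. c l * of_real (spline k (x + real q * a * of_int l - a * of_int m)))" for m
  define F where "F \<phi> = (\<Sum>m\<in>M. D m * cis (\<phi> * of_int m))" for \<phi>
  define G where "G \<phi> = (\<Sum>l\<in>S. c l * cis (\<phi> * of_int (int q * l)))" for \<phi>
  have FG: "F \<phi> = G \<phi> * modulated_sum a \<phi> k x" for \<phi>
  proof -
    have "F \<phi> = (\<Sum>l\<in>S. c l * (\<Sum>m\<in>M. cis (\<phi> * of_int m) * of_real (spline k (x + real q * a * of_int l - a * of_int m))))"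
      unfolding F_def D_def sum_distrib_right sum_distrib_left
      by (subst sum.swap) (simp add: mult_ac)
    also have "\<dots> = (\<Sum>l\<in>S. c l * modulated_sum a \<phi> k (x + real q * a * of_int l))"
      using mem by (intro sum.cong refl arg_cong2[of _ _ _ _ "(*)"] modulated_sum_eq[symmetric] M)
    also have "\<dots> = (\<Sum>l\<in>S. c l * (cis (\<phi> * of_int (int q * l)) * modulated_sum a \<phi> k x))"
      using modulated_sum_shift[of a \<phi> k x "int q * l" for l] by (simp add: mult_ac)
    also have "\<dots> = G \<phi> * modulated_sum a \<phi> k x" by (simp add: G_def sum_distrib_right mult.assoc)
    finally show ?thesis .
  qed
  have Fc: "continuous_on A F" and Gc: "continuous_on A G" for A
    unfolding F_def G_def by (intro continuous_intros)+
  have int: "h integrable_on {u..v}" if "continuous_on {u..v} h" for h :: "real \<Rightarrow> real" and u v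
    using that by (rule integrable_continuous_real)
  have "(2 * pi / real q) * (\<delta>\<^sup>2 * (\<Sum>l\<in>S. (cmod (c l))\<^sup>2)) = integral {- pi / q..pi / q} (\<lambda>\<phi>. \<delta>\<^sup>2 * (cmod (G \<phi>))\<^sup>2)"
    using parseval_trig_polynomial[of "2 * pi / real q" 1 S "- pi / q" c] S q
    by (simp add: G_def mult_ac)
  also have "\<dots> \<le> integral {- pi / q..pi / q} (\<lambda>\<phi>. (cmod (F \<phi>))\<^sup>2)"
  proof (intro integral_le int continuous_intros Fc Gc)
    fix \<phi> assume "\<phi> \<in> {- pi / real q..pi / real q}"
    then have "real q * \<bar>\<phi>\<bar> \<le> pi" using q by (auto simp: abs_if field_simps)
    then have "\<delta>\<^sup>2 \<le> (cmod (modulated_sum a \<phi> k x))\<^sup>2" using \<delta> by (intro power_mono) auto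
    then show "\<delta>\<^sup>2 * (cmod (G \<phi>))\<^sup>2 \<le> (cmod (F \<phi>))\<^sup>2"
      unfolding FG norm_mult power_mult_distrib by (subst mult.commute, intro mult_left_mono) auto
  qed
  also have "\<dots> \<le> integral {- pi..pi} (\<lambda>\<phi>. (cmod (F \<phi>))\<^sup>2)"
    using q by (intro integral_subset_le int continuous_intros Fc) (auto simp: field_simps)
  also have "\<dots> = 2 * pi * (\<Sum>m\<in>M. (cmod (D m))\<^sup>2)"
    using parseval_trig_polynomial[of "2 * pi" 1 M "- pi" D] M by (simp add: F_def mult_ac)
  finally show ?thesis using q by (simp add: D_def field_simps)
qed

text \<open>For continuous \<open>f\<close> with compact support the coefficients with index \<open>m\<close> are the Fourier
  coefficients of the continuous periodic function \<open>P m\<close>, to which Parseval's identity applies. The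
  values \<open>P m x\<close> are the inner sums of \<open>fiber_lower_bound\<close> for \<open>c l = f (x + T l)\<close>.\<close>

lemma gabor_lower_continuous:
  assumes a: "0 < a" and q: "1 \<le> q" and T: "T = real q * a" and k: "1 \<le> k"
    and \<delta>: "0 \<le> \<delta>" "\<And>x \<phi>. real q * \<bar>\<phi>\<bar> \<le> pi \<Longrightarrow> \<delta> \<le> cmod (modulated_sum a \<phi> k x)"
    and f: "continuous_on UNIV f" "\<And>x. R < \<bar>x\<bar> \<Longrightarrow> f x = 0" and R: "0 \<le> R"
    and sum: "(\<lambda>i. (cmod (gabor_coefficient (spline k) a T f i))\<^sup>2) summable_on UNIV"
  shows "a * \<delta>\<^sup>2 * (LINT x|lebesgue. (cmod (f x))\<^sup>2) \<le> (\<Sum>\<^sub>\<infinity>i. (cmod (gabor_coefficient (spline k) a T f i))\<^sup>2)"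
proof -
  have T0: "0 < T" using a q T by simp
  \<comment> \<open>Strictness makes \<open>{-L..L}\<close> contain every \<open>l\<close> with \<open>x + T l\<close> in the support of \<open>f\<close>, also for
    \<open>x = T\<close>.\<close>
  obtain L :: nat where L: "R < real L * T"
    using reals_Archimedean3[OF T0] by blast
  define S where "S = {- int L..int L}"
  define rad where "rad = (real k + 1) / 2"
  define M where "M = {m::int. \<bar>0 - a * of_int m\<bar> \<le> T + real L * T + rad}"
  have finM: "finite M" unfolding M_def using T0 a by (intro card_lattice_interval) (auto simp: rad_def)
  have memM: "m \<in> M" if "x \<in> {0..T}" "l \<in> S" "\<bar>x + T * of_int l - a * of_int m\<bar> < rad" for x l m
  proof -
    have "\<bar>T * of_int l\<bar> \<le> real L * T"
    proof -
      have "\<bar>real_of_int l\<bar> \<le> real L" using that(2) unfolding S_def by auto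
      then show ?thesis using T0 by (simp add: abs_mult mult.commute mult_right_mono)
    qed
    then show ?thesis using that(1,3) unfolding M_def by (auto simp: abs_if split: if_splits)
  qed
  define h where "h m x = f x * of_real (spline k (x - a * of_int m))" for m x
  have fc: "continuous_on A f" for A using f(1) by (rule continuous_on_subset) simp
  have hc: "continuous_on A (h m)" for A m
    unfolding h_def
    by (intro continuous_intros fc continuous_on_compose2[OF continuous_spline[OF k, of UNIV]]) auto
  have hs: "h m x = 0" if "R < \<bar>x\<bar>" for m x using f(2)[OF that] by (simp add: h_def)
  define P where "P m = periodization T R (h m)" for m
  have Pc: "continuous_on A (P m)" for A m
    using continuous_periodization[OF T0 hc hs R] unfolding P_def by (rule continuous_on_subset) auto
  have Peq: "P m x = (\<Sum>l\<in>S. h m (x + T * of_int l))" if "x \<in> {0..T}" for m x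
  proof -
    have "P m x = (\<Sum>l\<in>S. h m (x - T * of_int l))"
      unfolding P_def
    proof (rule periodization_eq)
      fix l :: int assume l: "\<bar>x - T * of_int l\<bar> \<le> R"
      have "T * of_int l < T * (real L + 1)" "T * (- real L) < T * of_int l"
        using l L that by (auto simp: algebra_simps abs_le_iff)
      then have "of_int l < real L + 1" "- real L < of_int l" using T0 by (auto simp only: mult_less_cancel_left_pos)
      then have "l \<le> int L" "- int L \<le> l" by linarith+
      then show "l \<in> S" by (auto simp: S_def)
    qed (auto simp: S_def hs)
    also have "\<dots> = (\<Sum>l\<in>S. h m (x + T * of_int l))"
      by (rule sum.reindex_bij_witness[of _ uminus uminus]) (auto simp: S_def)
    finally show ?thesis .
  qed
  have coeff: "gabor_coefficient (spline k) a T f (j, m) = integral {0..T} (\<lambda>x. P m x * cis (- (2 * pi * of_int j * x / T)))" for j m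
  proof -
    define e where "e x = cis (- (2 * pi * of_int j * x / T))" for x
    have ec: "continuous_on A e" for A unfolding e_def using T0 by (intro continuous_intros) auto
    have eper: "e (x + T * of_int l) = e x" for x l
    proof -
      have "- (2 * pi * of_int j * (x + T * of_int l) / T) = - (2 * pi * of_int j * x / T) + 2 * pi * of_int (- (j * l))"
        using T0 by (simp add: field_simps)
      then show ?thesis unfolding e_def by (simp only: cis_mult[symmetric] cis_multiple_2pi Ints_of_int mult_1_right)
    qed
    have "gabor_coefficient (spline k) a T f (j, m) = (LINT x|lebesgue. h m x * e x)"
      by (simp add: gabor_coefficient_def h_def e_def)
    also have "\<dots> = integral {0..T} (\<lambda>x. \<Sum>l\<in>S. h m (x + T * of_int l) * e (x + T * of_int l))"
      unfolding S_def using L hs by (intro integral_fold_period T0 continuous_intros hc ec) auto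
    also have "\<dots> = integral {0..T} (\<lambda>x. P m x * e x)"
      by (intro integral_cong) (simp add: Peq eper sum_distrib_right)
    finally show ?thesis by (simp add: e_def)
  qed
  have main: "a * \<delta>\<^sup>2 * (LINT x|lebesgue. (cmod (f x))\<^sup>2) \<le> (\<Sum>m\<in>M. T * integral {0..T} (\<lambda>x. (cmod (P m x))\<^sup>2))"
  proof -
    have "(LINT x|lebesgue. (cmod (f x))\<^sup>2) = integral {0..T} (\<lambda>x. \<Sum>l\<in>S. (cmod (f (x + T * of_int l)))\<^sup>2)"
      unfolding S_def using L f(2) by (intro integral_fold_period T0 continuous_intros fc) auto
    then have "a * \<delta>\<^sup>2 * (LINT x|lebesgue. (cmod (f x))\<^sup>2)
        = integral {0..T} (\<lambda>x. a * (\<delta>\<^sup>2 * (\<Sum>l\<in>S. (cmod (f (x + T * of_int l)))\<^sup>2)))"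
      by (simp add: mult.assoc)
    also have "\<dots> \<le> integral {0..T} (\<lambda>x. T * (\<Sum>m\<in>M. (cmod (P m x))\<^sup>2))"
    proof (intro integral_le integrable_continuous_real continuous_intros Pc continuous_on_compose2[OF f(1)])
      fix x assume x: "x \<in> {0..T}"
      have "\<delta>\<^sup>2 * (\<Sum>l\<in>S. (cmod (f (x + T * of_int l)))\<^sup>2) \<le> real q * (\<Sum>m\<in>M. (cmod (P m x))\<^sup>2)"
        using fiber_lower_bound[OF a q _ finM, of S x k \<delta> "\<lambda>l. f (x + T * of_int l)"] memM[OF x] \<delta>
        by (simp add: Peq[OF x] h_def T[symmetric] rad_def S_def)
      then show "a * (\<delta>\<^sup>2 * (\<Sum>l\<in>S. (cmod (f (x + T * of_int l)))\<^sup>2)) \<le> T * (\<Sum>m\<in>M. (cmod (P m x))\<^sup>2)"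
        using a mult_left_mono[OF _ less_imp_le[OF a]] by (simp add: T mult.assoc mult.left_commute)
    qed auto
    also have "\<dots> = (\<Sum>m\<in>M. T * integral {0..T} (\<lambda>x. (cmod (P m x))\<^sup>2))"
      unfolding Henstock_Kurzweil_Integration.integral_mult_right sum_distrib_left[symmetric]
      by (subst integral_sum[OF finM]) (auto intro!: integrable_continuous_real continuous_intros Pc)
    finally show ?thesis .
  qed
  show ?thesis
  proof (rule field_le_epsilon)
    fix \<epsilon> :: real assume "0 < \<epsilon>"
    define \<epsilon>' where "\<epsilon>' = \<epsilon> / (real (card M) + 1)"
    have \<epsilon>': "0 < \<epsilon>'" using \<open>0 < \<epsilon>\<close> by (simp add: \<epsilon>'_def)
    have "\<exists>K. finite K \<and> T * integral {0..T} (\<lambda>x. (cmod (P m x))\<^sup>2) \<le> (\<Sum>j\<in>K. (cmod (gabor_coefficient (spline k) a T f (j, m)))\<^sup>2) + \<epsilon>'" for m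
    proof -
      have per: "P m (x + T) = P m x" for x by (simp add: P_def periodization_periodic)
      show ?thesis unfolding coeff
        using parseval_continuous_periodic[OF T0 Pc[of UNIV m] per \<epsilon>'] by blast
    qed
    then obtain K where K: "\<And>m. finite (K m)"
      "\<And>m. T * integral {0..T} (\<lambda>x. (cmod (P m x))\<^sup>2) \<le> (\<Sum>j\<in>K m. (cmod (gabor_coefficient (spline k) a T f (j, m)))\<^sup>2) + \<epsilon>'"
      by metis
    note main
    also have "(\<Sum>m\<in>M. T * integral {0..T} (\<lambda>x. (cmod (P m x))\<^sup>2))
      \<le> (\<Sum>m\<in>M. (\<Sum>j\<in>K m. (cmod (gabor_coefficient (spline k) a T f (j, m)))\<^sup>2) + \<epsilon>')"
      by (intro sum_mono K(2))
    also have "\<dots> = (\<Sum>m\<in>M. \<Sum>j\<in>K m. (cmod (gabor_coefficient (spline k) a T f (j, m)))\<^sup>2) + real (card M) * \<epsilon>'"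
      by (simp add: sum.distrib)
    also have "(\<Sum>m\<in>M. \<Sum>j\<in>K m. (cmod (gabor_coefficient (spline k) a T f (j, m)))\<^sup>2)
      = (\<Sum>i\<in>prod.swap ` Sigma M K. (cmod (gabor_coefficient (spline k) a T f i))\<^sup>2)"
      using finM K(1) by (subst sum.Sigma) (auto simp: sum.reindex inj_on_def intro!: sum.cong)
    also have "\<dots> \<le> (\<Sum>\<^sub>\<infinity>i. (cmod (gabor_coefficient (spline k) a T f i))\<^sup>2)"
      using finM K(1) by (intro finite_sum_le_infsum sum) auto
    also have "real (card M) * \<epsilon>' \<le> \<epsilon>"
      using \<open>0 < \<epsilon>\<close> by (simp add: \<epsilon>'_def field_simps)
    finally show "a * \<delta>\<^sup>2 * (LINT x|lebesgue. (cmod (f x))\<^sup>2)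
      \<le> (\<Sum>\<^sub>\<infinity>i. (cmod (gabor_coefficient (spline k) a T f i))\<^sup>2) + \<epsilon>" by simp
  qed
qed

text \<open>The lower bound passes from the dense subspace to all of \<open>L\<^sup>2\<close> because the upper bound controls the
  coefficients of the difference. Using \<open>|z + w|\<^sup>2 \<le> 2 |z|\<^sup>2 + 2 |w|\<^sup>2\<close> twice costs the factor \<open>4\<close>.\<close>

theorem gabor_spline_frame:
  assumes a: "0 < a" "1 \<le> real q * a" and q: "2 \<le> q" and k: "1 \<le> k" "a < real k + 1"
  shows "L2_frame (gabor_system (\<lambda>x. complex_of_real (spline k x)) a (1 / (real q * a)))"
proof -
  define T where "T = real q * a"
  have T: "0 < T" using a by (simp add: T_def)
  define c where "c f i = (cmod (gabor_coefficient (spline k) a T f i))\<^sup>2" for f i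
  define nrm where "nrm f = (LINT x|lebesgue. (cmod (f x))\<^sup>2)" for f :: "real \<Rightarrow> complex"
  have c: "c f i = (cmod (L2_inner f (gabor_system (\<lambda>x. complex_of_real (spline k x)) a (1 / (real q * a)) i)))\<^sup>2" for f i
    by (simp add: c_def gabor_coefficient_eq_inner T_def)
  have nrm0: "0 \<le> nrm f" for f unfolding nrm_def by simp
  obtain C where C: "\<And>x. \<bar>spline k x\<bar> \<le> C" using spline_bounded[OF k(1)] by blast
  obtain B where B: "0 < B" "\<And>f \<Omega>. f \<in> L2 \<Longrightarrow> finite \<Omega> \<Longrightarrow> sum (c f) \<Omega> \<le> B * nrm f"
    using gabor_spline_bessel[OF a(1) T k(1)] unfolding c_def nrm_def by blast
  have summ: "c f summable_on UNIV" if "f \<in> L2" for f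
    by (rule nonneg_bounded_partial_sums_imp_summable_on[where C = "B * nrm f"])
      (auto simp: c_def B(2)[OF that, unfolded c_def] intro!: eventually_finite_subsets_at_top_weakI)
  have up: "infsum (c f) UNIV \<le> B * nrm f" if "f \<in> L2" for f
    by (intro infsum_le_finite_sums summ that B(2))
  obtain \<delta> where \<delta>: "0 < \<delta>" "\<And>x \<phi>. real q * \<bar>\<phi>\<bar> \<le> pi \<Longrightarrow> \<delta> \<le> cmod (modulated_sum a \<phi> k x)"
    using modulated_sum_bounded_below[OF a q k(2,1)] by blast
  define A where "A = a * \<delta>\<^sup>2"
  have A: "0 < A" using a \<delta> by (simp add: A_def)
  have low: "A / 4 * nrm f \<le> infsum (c f) UNIV" if f: "f \<in> L2" for f
  proof -
    have "A * nrm f \<le> 4 * infsum (c f) UNIV"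
    proof (rule field_le_epsilon)
      fix \<epsilon> :: real assume "0 < \<epsilon>"
      \<comment> \<open>The error made by replacing \<open>f\<close> with \<open>g\<close> adds up to \<open>(4 B + 2 A) \<eta>\<close>.\<close>
      define \<eta> where "\<eta> = \<epsilon> / (4 * B + 2 * A)"
      have \<eta>: "0 < \<eta>" using \<open>0 < \<epsilon>\<close> A B by (simp add: \<eta>_def)
      obtain g R where g: "continuous_on UNIV g" "\<And>x. R < \<bar>x\<bar> \<Longrightarrow> g x = 0" "g \<in> L2"
        "nrm (\<lambda>x. f x - g x) < \<eta>"
        using L2_dense_continuous[OF f \<eta>] unfolding nrm_def by blast
      have d: "(\<lambda>x. f x - g x) \<in> L2" by (rule L2_diff[OF f g(3)])
      have "c g i \<le> 2 * c f i + 2 * c (\<lambda>x. f x - g x) i" for i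
      proof -
        have "gabor_coefficient (spline k) a T (\<lambda>x. f x - g x) i = gabor_coefficient (spline k) a T f i - gabor_coefficient (spline k) a T g i"
          using spline_eq_0[of k] by (intro gabor_coefficient_diff[OF f g(3) continuous_spline[OF k(1)] C, of "(real k + 1) / 2"]) auto
        then show ?thesis
          using cmod_add_square_le[of "gabor_coefficient (spline k) a T f i" "- gabor_coefficient (spline k) a T (\<lambda>x. f x - g x) i"]
          by (simp add: c_def norm_minus_commute)
      qed
      then have "infsum (c g) UNIV \<le> (\<Sum>\<^sub>\<infinity>i. 2 * c f i + 2 * c (\<lambda>x. f x - g x) i)"
        by (intro infsum_mono summ g(3) summable_on_add summable_on_cmult_right f d) auto
      also have "\<dots> = 2 * infsum (c f) UNIV + 2 * infsum (c (\<lambda>x. f x - g x)) UNIV"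
        by (subst infsum_add) (auto intro!: summable_on_cmult_right summ f d simp: infsum_cmult_right')
      also have "infsum (c (\<lambda>x. f x - g x)) UNIV \<le> B * \<eta>"
        using up[OF d] g(4) B(1) by (meson less_imp_le mult_left_mono order_trans)
      finally have 1: "infsum (c g) UNIV \<le> 2 * infsum (c f) UNIV + 2 * (B * \<eta>)" by simp
      have "A * nrm g \<le> infsum (c g) UNIV"
        unfolding A_def nrm_def c_def
      proof (rule gabor_lower_continuous[OF a(1) _ T_def k(1) less_imp_le[OF \<delta>(1)] \<delta>(2) g(1), where R = "max R 0"])
        show "(\<lambda>i. (cmod (gabor_coefficient (spline k) a T g i))\<^sup>2) summable_on UNIV"
          using summ[OF g(3)] by (simp add: c_def[abs_def])
      qed (use q g(2) in auto)
      with 1 have 2: "A * nrm g \<le> 2 * infsum (c f) UNIV + 2 * (B * \<eta>)" by linarith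
      have "nrm f \<le> 2 * nrm g + 2 * nrm (\<lambda>x. f x - g x)"
        using L2_norm_square_triangle[OF f g(3)] by (simp add: nrm_def)
      then have "nrm f \<le> 2 * nrm g + 2 * \<eta>" using g(4) by linarith
      then have "A * nrm f \<le> A * (2 * nrm g + 2 * \<eta>)" using A by (intro mult_left_mono) auto
      also have "\<dots> \<le> 4 * infsum (c f) UNIV + (4 * B + 2 * A) * \<eta>" using 2 by (simp add: algebra_simps)
      also have "(4 * B + 2 * A) * \<eta> = \<epsilon>" using A B by (simp add: \<eta>_def)
      finally show "A * nrm f \<le> 4 * infsum (c f) UNIV + \<epsilon>" .
    qed
    then show ?thesis by simp
  qed
  show ?thesis
    unfolding L2_frame_def c[symmetric] L2_norm_square nrm_def[symmetric]
    using gabor_spline_in_L2[OF k(1)] A B(1) summ up low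
    by (intro conjI allI exI[of _ "A / 4"] exI[of _ B]) auto
qed

section \<open>The critical translation step\<close>

text \<open>If \<open>a \<ge> k + 1\<close>, the supports of different translates have disjoint interiors, and the sum of the
  squared translates tends to \<open>0\<close> at the end point \<open>R\<close> of the support of \<open>spline k\<close>.\<close>

theorem gabor_spline_frame_imp:
  assumes a: "0 < a" and T: "0 < T" and k: "1 \<le> k"
    and frame: "L2_frame (gabor_system (\<lambda>x. complex_of_real (spline k x)) a (1 / T))"
  shows "a < real k + 1"
proof (rule ccontr)
  assume "\<not> a < real k + 1"
  define R where "R = (real k + 1) / 2"
  have R: "0 < R" "2 * R \<le> a" using \<open>\<not> a < real k + 1\<close> by (auto simp: R_def)
  obtain A where A: "0 < A" and low: "\<And>f. f \<in> L2 \<Longrightarrow>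
      A * (LINT x|lebesgue. (cmod (f x))\<^sup>2) \<le> (\<Sum>\<^sub>\<infinity>i. (cmod (gabor_coefficient (spline k) a T f i))\<^sup>2)"
    and summ: "\<And>f. f \<in> L2 \<Longrightarrow> (\<lambda>i. (cmod (gabor_coefficient (spline k) a T f i))\<^sup>2) summable_on UNIV"
    using frame unfolding L2_frame_def gabor_coefficient_eq_inner[symmetric] L2_norm_square by blast
  \<comment> \<open>On the chosen interval the frame sum will be at most \<open>T \<eta>\<close> times the squared norm, that is, half
    of what the lower bound requires.\<close>
  define \<eta> where "\<eta> = A / (2 * T)"
  have \<eta>: "0 < \<eta>" using A T by (simp add: \<eta>_def)
  have "isCont (\<lambda>x. (spline k x)\<^sup>2) R"
    using continuous_spline[OF k, of UNIV] by (intro continuous_intros) (simp add: continuous_on_eq_continuous_at)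
  then obtain d0 where d0: "0 < d0" "\<And>x. \<bar>x - R\<bar> < d0 \<Longrightarrow> \<bar>(spline k x)\<^sup>2 - (spline k R)\<^sup>2\<bar> < \<eta>"
    using \<eta> unfolding continuous_at_eps_delta dist_real_def by blast
  \<comment> \<open>The condition \<open>d \<le> T\<close> allows the Bessel inequality with a single period.\<close>
  define d where "d = min (d0 / 2) (min R T)"
  have d: "0 < d" "d < d0" "d \<le> R" "d \<le> T" using d0 R T by (auto simp: d_def)
  have small: "(spline k x)\<^sup>2 \<le> \<eta>" if "x \<in> {R - d..R}" for x
  proof -
    have "\<bar>x - R\<bar> < d0" using that d by auto
    from d0(2)[OF this] show ?thesis using spline_eq_0[of k R] by (simp add: R_def)
  qed
  define f where "f x = complex_of_real (indicator {R - d..R} x)" for x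
  have fsq: "(cmod (f x))\<^sup>2 = indicator {R - d..R} x" for x by (simp add: f_def indicator_def)
  have f: "f \<in> L2"
  proof (rule L2_bounded_support)
    have "f \<in> borel_measurable borel" unfolding f_def by measurable
    then show "f \<in> borel_measurable lebesgue" by (simp add: measurable_completion)
    show "cmod (f x) \<le> 1" for x by (simp add: f_def indicator_def)
    show "f x = 0" if "R < \<bar>x\<bar>" for x using that d by (auto simp: f_def indicator_def)
  qed
  have nf: "(LINT x|lebesgue. (cmod (f x))\<^sup>2) = d" using d by (simp add: fsq)
  obtain C where C: "\<And>x. \<bar>spline k x\<bar> \<le> C" using spline_bounded[OF k] by blast
  have only0: "spline k (x - a * of_int m) = 0" if "f x \<noteq> 0" "m \<noteq> 0" for x m
  proof -
    have x: "R - d \<le> x" "x \<le> R" using that(1) by (auto simp: f_def indicator_def split: if_splits)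
    have "a \<le> \<bar>a * of_int m\<bar>"
    proof -
      have "1 \<le> \<bar>real_of_int m\<bar>" using that(2) by linarith
      then show ?thesis using a by (simp add: abs_mult)
    qed
    then have "R \<le> \<bar>x - a * of_int m\<bar>" using x R d by linarith
    then show ?thesis using spline_eq_0[of k] by (simp add: R_def)
  qed
  have "(\<Sum>\<^sub>\<infinity>i. (cmod (gabor_coefficient (spline k) a T f i))\<^sup>2) \<le> real 1 * T * \<eta> * d"
  proof (rule infsum_le_finite_sums[OF summ[OF f]])
    fix \<Omega> :: "(int \<times> int) set" assume \<Omega>: "finite \<Omega>"
    show "(\<Sum>i\<in>\<Omega>. (cmod (gabor_coefficient (spline k) a T f i))\<^sup>2) \<le> real 1 * T * \<eta> * d"
      unfolding nf[symmetric]
    proof (rule gabor_sum_le[OF f T le_refl continuous_spline[OF k] C _ _ \<Omega>])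
      show "x \<in> {R - d..R - d + real 1 * T}" if "f x \<noteq> 0" for x
        using that d by (auto simp: f_def indicator_def split: if_splits)
      show "(\<Sum>m\<in>M. (spline k (x - a * of_int m))\<^sup>2) \<le> \<eta>" if "f x \<noteq> 0" "finite M" for x M
      proof -
        have "(\<Sum>m\<in>M. (spline k (x - a * of_int m))\<^sup>2) = (\<Sum>m\<in>M \<inter> {0}. (spline k (x - a * of_int m))\<^sup>2)"
          using that only0 by (intro sum.mono_neutral_right) auto
        also have "\<dots> \<le> (spline k x)\<^sup>2" by (cases "0 \<in> M") auto
        also have "\<dots> \<le> \<eta>" using that(1) by (intro small) (auto simp: f_def indicator_def split: if_splits)
        finally show ?thesis .
      qed
    qed
  qed
  with low[OF f] have "A * d \<le> T * \<eta> * d" by (simp add: nf)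
  also have "T * \<eta> * d = A / 2 * d" using T by (simp add: \<eta>_def)
  finally have "A \<le> A / 2" using d(1) by (rule mult_right_le_imp_le)
  then show False using A by simp
qed

section \<open>Characterization of the frames\<close>

theorem theorem7p1:
  fixes n q :: nat and a b :: real
  assumes "n \<ge> 2" and "q \<ge> 2" and "a > 0" and "0 < b" and "b \<le> 1"
    and "a * b = 1 / real q"
  shows "L2_frame (gabor_system (\<lambda>x. complex_of_real (bspline n x)) a (1 / (real q * a)))
    \<longleftrightarrow> a < real n"
proof -
  obtain j where n: "n = Suc (Suc j)" using \<open>n \<ge> 2\<close> by (metis add_2_eq_Suc le_Suc_ex)
  have "1 / b = real q * a" using assms by (simp add: field_simps)
  moreover have "1 \<le> 1 / b" using assms by simp
  ultimately have qa: "1 \<le> real q * a" by simp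
  then have "0 < real q * a" by linarith
  then show ?thesis
    unfolding n bspline_eq_spline
    using gabor_spline_frame[OF \<open>a > 0\<close> qa \<open>q \<ge> 2\<close>, of "Suc j"]
      gabor_spline_frame_imp[OF \<open>a > 0\<close>, of "real q * a" "Suc j"] by auto
qed

end
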